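(* Assume the following for every integer $k\ge 1$. (i) There is a polynomial $\overline{h}_k(x)\in\mathbb{Q}[x]$ such that $\overline{h}_k(m)=A_{\overline{\mathcal{K}},k,m}(0)$ for all integers $m\ge 3$. Write $\overline{h}_k(x)=\nu_k\,\tilde{p}_k(x)$ with $\nu_k\in\mathbb{Q}$ and $\tilde{p}_k(x)\in\mathbb{Q}[x]$ monic. (ii) $\nu_k=24\,a_k$. (iii) $\tilde{p}_k(3)$ is odd, i.e. $\operatorname{ord}_2(\tilde{p}_k(3))=0$. (iv) $\operatorname{ord}_2(a_k)=3d_2(k)-3$. (v) $\operatorname{ord}_3(\tilde{p}_k(3))=d_3(k)-1$. Then for every integer $k\ge 1$, $$\operatorname{ord}_2\bigl(A_{\overline{\mathcal{K}},k,3}(0)\bigr)=3d_2(k)\qquad\text{and}\qquad \operatorname{ord}_3\bigl(A_{\overline{\mathcal{K}},k,3}(0)\bigr)=d_3(k).$$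
   Context: For a prime $p$, $\operatorname{ord}_p$ denotes the $p$-adic valuation on $\mathbb{Q}$. For an integer $b\ge 2$, $d_b(k)$ is the sum of the digits of $k$ in base $b$. The sequence $(a_k)_{k\ge 0}=(0,1,47,2488,138799,\dots)$ is O.E.I.S. sequence A005148, studied by Newman, Shanks and Zagier: for $k\ge 1$, $24a_k$ is the coefficient of $x^k$ in $\prod_{i\ge 1}(1+x^{2i-1})^{24k}$, and $a_0=0$. For $m\ge 3$ let $\lambda_m=2\cos(\pi/m)$ and let $G(\lambda_m)$ be the Hecke group generated by $\tau\mapsto\tau+\lambda_m$ and $\tau\mapsto -1/\tau$ acting on the upper half plane. Let $J_m$ be the generator of the field of modular functions for $G(\lambda_m)$ that is holomorphic on the upper half plane, has a simple pole at the cusp $i\infty$, and is normalized by $J_m(i)=1$ and $J_m(-e^{-\pi i/m})=0$. It has a Fourier expansion $J_m(\tau)=\sum_{n\ge -1}a_n(m)q_m^n$ with $q_m=\exp(2\pi i\tau/\lambda_m)$ (these coefficients $a_n(m)$ are unrelated to the sequence $a_k$). Put $X_m=q_m/a_{-1}(m)$, so that $J_m=\sum_{n\ge -1}c_n(m)X_m^n$ with $c_n(m)=a_n(m)a_{-1}(m)^n$ and $c_{-1}(m)=1$. Define $j_m$ as the Laurent series in $X_m$ obtained from that of $J_m$ by replacing $X_m$ by $2^6m^3X_m$ and dividing by the resulting leading coefficient: $$j_m=\sum_{n\ge -1}c_n(m)\,(2^6m^3)^{n+1}X_m^n .$$ For $m=3$ this is $1/X_3+744+196884X_3+21493760X_3^2+\cdots$,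 the usual expansion of the Klein invariant $j$ (with $X_3$ in place of $\exp(2\pi i\tau)$). Let $\overline{\mathcal{K}}=\{j_3,j_4,\dots\}$. For $k\ge 1$, $A_{\overline{\mathcal{K}},k,m}(0)$ denotes the constant term (coefficient of $X_m^0$) of the Laurent series $j_m^k$. In particular $A_{\overline{\mathcal{K}},k,3}(0)$ is the constant term of the Fourier expansion of $j^k$. *)

theory Defs
  imports
    "HOL-Complex_Analysis.Complex_Analysis"
    "HOL-Algebra.Bij"
    "HOL-Algebra.Generated_Groups"
    "HOL-Computational_Algebra.Computational_Algebra"
    "HOL-Library.Extended"
begin

subsection \<open>Valuations and digit sums\<close>

text \<open>Values lie in \<open>int extended\<close> so that \<open>ord\<^sub>p(0) = \<infinity>\<close>; in particular an equation
  \<open>padic_ord p x = Fin n\<close> includes \<open>x \<noteq> 0\<close>.\<close>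

definition padic_ord :: "nat \<Rightarrow> rat \<Rightarrow> int extended" where
  "padic_ord p x =
     (if x = 0 then \<infinity>
      else Fin (int (multiplicity (int p) (fst (quotient_of x)))
              - int (multiplicity (int p) (snd (quotient_of x)))))"

text \<open>The value for bases \<open>b < 2\<close> is a dummy.\<close>

fun digit_sum :: "nat \<Rightarrow> nat \<Rightarrow> nat" where
  "digit_sum b k = (if b < 2 \<or> k = 0 then 0 else k mod b + digit_sum b (k div b))"

declare digit_sum.simps [simp del]


subsection \<open>The Newman--Shanks--Zagier sequence\<close>

text \<open>The infinite product is taken in the \<open>X\<close>-adic topology on formal power series. Its factors
  are indexed from \<open>0\<close>, so the \<open>i\<close>-th exponent is \<open>2i + 1\<close>.\<close>

definition nsz_product :: "nat \<Rightarrow> rat fps" where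
  "nsz_product k = (\<Prod>i. (1 + fps_X ^ (2 * i + 1)) ^ (24 * k))"

definition nsz_seq :: "nat \<Rightarrow> rat" where
  "nsz_seq k = (if k = 0 then 0 else fps_nth (nsz_product k) k / 24)"


subsection \<open>Hecke groups and their modular functions\<close>

definition upper_half_plane :: "complex set" where
  "upper_half_plane = {\<tau>. Im \<tau> > 0}"

definition hecke_lambda :: "nat \<Rightarrow> real" where
  "hecke_lambda m = 2 * cos (pi / real m)"

text \<open>The group is taken as a group of transformations of the upper half plane.\<close>

definition hecke_group :: "real \<Rightarrow> (complex \<Rightarrow> complex) set" where
  "hecke_group l = generate (BijGroup upper_half_plane)
     {\<lambda>\<tau>\<in>upper_half_plane. \<tau> + of_real l, \<lambda>\<tau>\<in>upper_half_plane. - 1 / \<tau>}"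

text \<open>For \<open>f\<close> of period \<open>l\<close> on the upper half plane, the function \<open>F\<close> on the punctured unit disc
  with \<open>f \<tau> = F (exp (2 \<pi> \<i> \<tau> / l))\<close>. The periodicity makes the branch of the logarithm irrelevant.
  The point \<open>q = 0\<close> is the cusp at infinity.\<close>

definition cusp_fun :: "real \<Rightarrow> (complex \<Rightarrow> complex) \<Rightarrow> complex \<Rightarrow> complex" where
  "cusp_fun l f q = f (of_real l / (2 * of_real pi * \<i>) * Ln q)"

definition modular_functions :: "real \<Rightarrow> (complex \<Rightarrow> complex) set" where
  "modular_functions l =
     {f. f nicely_meromorphic_on upper_half_plane \<and>
         (\<forall>g\<in>hecke_group l. \<forall>\<tau>\<in>upper_half_plane. f (g \<tau>) = f \<tau>) \<and>
         cusp_fun l f meromorphic_on {0}}"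

text \<open>\<open>J\<close> generates the field over the complex numbers: each modular function is a rational
  function of \<open>J\<close> (an equality of meromorphic functions, hence tested where the denominator
  does not vanish).\<close>

definition generates_modular_functions :: "real \<Rightarrow> (complex \<Rightarrow> complex) \<Rightarrow> bool" where
  "generates_modular_functions l J \<longleftrightarrow>
     J \<in> modular_functions l \<and>
     (\<forall>f\<in>modular_functions l. \<exists>P Q :: complex poly. Q \<noteq> 0 \<and>
        (\<forall>\<tau>\<in>upper_half_plane. poly Q (J \<tau>) \<noteq> 0 \<longrightarrow> f \<tau> = poly P (J \<tau>) / poly Q (J \<tau>)))"

text \<open>These conditions determine \<open>J\<close> uniquely on the upper half plane; its values elsewhere
  do not matter below.\<close>

definition hecke_hauptmodul :: "nat \<Rightarrow> (complex \<Rightarrow> complex) \<Rightarrow> bool" where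
  "hecke_hauptmodul m J \<longleftrightarrow>
     generates_modular_functions (hecke_lambda m) J \<and>
     J holomorphic_on upper_half_plane \<and>
     is_pole (cusp_fun (hecke_lambda m) J) 0 \<and>
     zorder (cusp_fun (hecke_lambda m) J) 0 = -1 \<and>
     J \<i> = 1 \<and>
     J (- exp (- (of_real pi * \<i> / of_nat m))) = 0"


subsection \<open>Rescaled Fourier expansions\<close>

definition fourier_coeff :: "nat \<Rightarrow> (complex \<Rightarrow> complex) \<Rightarrow> int \<Rightarrow> complex" where
  "fourier_coeff m J n = fls_nth (laurent_expansion (cusp_fun (hecke_lambda m) J) 0) n"

text \<open>The coefficients with respect to \<open>X\<^sub>m = q\<^sub>m / a\<^sub>-\<^sub>1(m)\<close>.\<close>

definition normalized_coeff :: "nat \<Rightarrow> (complex \<Rightarrow> complex) \<Rightarrow> int \<Rightarrow> complex" where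
  "normalized_coeff m J n = fourier_coeff m J n * fourier_coeff m J (-1) powi n"

text \<open>A Laurent series in \<open>X\<^sub>m\<close>. The shift multiplies by \<open>X\<^sub>m\<^sup>-\<^sup>1\<close>, so the coefficient of
  \<open>X\<^sub>m\<^sup>n\<close> for \<open>n \<ge> -1\<close> is \<open>c\<^sub>n(m) (2\<^sup>6 m\<^sup>3)\<^sup>n\<^sup>+\<^sup>1\<close>; see \<open>hecke_j_nth\<close>.\<close>

definition hecke_j :: "nat \<Rightarrow> (complex \<Rightarrow> complex) \<Rightarrow> complex fls" where
  "hecke_j m J = fls_shift 1 (fps_to_fls
     (Abs_fps (\<lambda>n. normalized_coeff m J (int n - 1) * (2 ^ 6 * of_nat m ^ 3) ^ n)))"

lemma hecke_j_nth:
  "fls_nth (hecke_j m J) n =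
     (if n < -1 then 0 else normalized_coeff m J n * (2 ^ 6 * of_nat m ^ 3) powi (n + 1))"
proof (cases "n < -1")
  case True
  then show ?thesis by (simp add: hecke_j_def)
next
  case False
  then obtain i where "n + 1 = int i"
    by (metis add.commute add_neg_numeral_special(7) add_le_cancel_left linorder_not_less
        nonneg_int_cases)
  then have "n = int i - 1" by simp
  then show ?thesis by (simp add: hecke_j_def)
qed

definition const_term :: "(nat \<Rightarrow> complex \<Rightarrow> complex) \<Rightarrow> nat \<Rightarrow> nat \<Rightarrow> complex" where
  "const_term J k m = fls_nth (hecke_j m (J m) ^ k) 0"

end

theory Submission
  imports Defs
begin

text \<open>
  Evaluating the interpolating polynomial at \<open>3\<close> gives the constant term \<open>24 a\<^sub>k p\<^sub>k(3)\<close>. Since valuations are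
  additive, the \<open>2\<close>-adic claim is \<open>3 + (3 d\<^sub>2(k) - 3) + 0 = 3 d\<^sub>2(k)\<close>. The \<open>3\<close>-adic valuation is
  \<open>1 + ord\<^sub>3(a\<^sub>k) + (d\<^sub>3(k) - 1)\<close>, so the \<open>3\<close>-adic claim amounts to the fact that \<open>3\<close> never divides \<open>a\<^sub>k\<close>. This
  fact is the mathematical content of the development. More precisely, modulo \<open>3\<close> the number \<open>a\<^sub>k\<close> is the last
  nonzero ternary digit of \<open>k\<close>; this follows from two congruences.

  Write \<open>P = \<Prod>(1 + X\<^bsup>2i-1\<^esup>)\<close>, so that \<open>24 a\<^sub>k\<close> is the coefficient of \<open>X\<^sup>k\<close> in \<open>P\<^bsup>24k\<^esup>\<close>.

  First, \<open>a\<^bsub>3k\<^esub> = a\<^sub>k\<close> modulo \<open>3\<close> (\<open>nsz_int_triple\<close>). The reason is the Frobenius congruence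
  \<open>P\<^sup>9 = P(X\<^sup>3)\<^sup>3\<close> modulo \<open>9\<close>.

  Second, \<open>k a\<^sub>k = 1\<close> modulo \<open>3\<close> if \<open>3\<close> does not divide \<open>k\<close> (\<open>nsz_int_mod_3\<close>). Here the theta series
  \<open>\<theta> = \<Sum> X\<^bsup>j\<^sup>2\<^esup> = \<Prod>(1 - X\<^bsup>2i\<^esup>) P\<^sup>2\<close> enters. Splitting the sum by \<open>j\<close> modulo \<open>3\<close> gives
  \<open>\<theta>(X\<^sup>9) + 2 X \<Sum> X\<^bsup>9j\<^sup>2+6j\<^esup>\<close>. The triple product expresses both parts as products, and modulo \<open>3\<close> these combine to
  \<open>\<theta> = (1 - t) \<theta>(X\<^sup>9)\<close> with \<open>t = X / P\<^bsup>24\<^esup>\<close> (\<open>theta_congruence\<close>). The logarithmic derivative of this relation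
  is \<open>Q - Y = t / (1 - t)\<close> modulo \<open>3\<close> (\<open>lambert_congruence\<close>), where \<open>Q\<close> is the logarithmic derivative of \<open>P\<close> and
  \<open>Y = \<Sum> \<sigma>(n) X\<^bsup>2n\<^esup>\<close>. Because \<open>3\<close> divides \<open>\<sigma>(n)\<close> whenever \<open>n\<close> is \<open>2\<close> modulo \<open>3\<close>, the \<open>n\<close>-th coefficient of
  \<open>Q - Y\<close> is \<open>n\<close> times that of \<open>Q\<close> when \<open>3\<close> does not divide \<open>n\<close>. As \<open>a\<^sub>k\<close> is the coefficient of \<open>X\<^sup>k\<close> in
  \<open>P\<^bsup>24k\<^esup> Q\<close>, it follows that \<open>k a\<^sub>k\<close> is the coefficient of \<open>X\<^sup>k\<close> in \<open>P\<^bsup>24k\<^esup> t / (1 - t)\<close>, that is, the sum over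
  \<open>j < k\<close> of the coefficients of \<open>X\<^sup>j\<close> in \<open>P\<^bsup>24j\<^esup>\<close>. Only \<open>j = 0\<close> survives modulo \<open>3\<close>, since the others are
  \<open>24 a\<^sub>j\<close>.

  The infinite products and theta series are handled through finite products, for which a \<open>q\<close>-binomial identity
  replaces the Jacobi triple product, and congruences modulo a power of \<open>X\<close>.
\<close>

section \<open>Congruences of truncated power series\<close>

text \<open>Congruence modulo the ideal generated by \<open>m\<close> and \<open>X\<^sup>K\<close>. Truncation lets finite products stand in for
  infinite ones, and \<open>m = 0\<close> gives plain equality of truncations.\<close>
definition fps_cong :: "int \<Rightarrow> nat \<Rightarrow> int fps \<Rightarrow> int fps \<Rightarrow> bool" where
  "fps_cong m K f g \<longleftrightarrow> (\<forall>n<K. m dvd fps_nth f n - fps_nth g n)"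

lemma fps_congD: "fps_cong m K f g \<Longrightarrow> n < K \<Longrightarrow> m dvd fps_nth f n - fps_nth g n"
  by (simp add: fps_cong_def)

lemma fps_cong_refl [simp, intro]: "fps_cong m K f f"
  by (simp add: fps_cong_def)

lemma fps_cong_sym: "fps_cong m K f g \<Longrightarrow> fps_cong m K g f"
  by (simp add: fps_cong_def dvd_diff_commute)

lemma fps_cong_trans [trans]: "fps_cong m K f g \<Longrightarrow> fps_cong m K g h \<Longrightarrow> fps_cong m K f h"
  unfolding fps_cong_def by (metis diff_add_cancel add_diff_eq dvd_add)

lemma fps_cong_diff_iff: "fps_cong m K f g \<longleftrightarrow> fps_cong m K (f - g) 0"
  by (simp add: fps_cong_def)

lemma fps_cong_add: "fps_cong m K f f' \<Longrightarrow> fps_cong m K g g' \<Longrightarrow> fps_cong m K (f + g) (f' + g')"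
  unfolding fps_cong_def by (metis add_diff_add dvd_add fps_add_nth)

lemma fps_cong_uminus: "fps_cong m K f f' \<Longrightarrow> fps_cong m K (- f) (- f')"
  unfolding fps_cong_def by (metis dvd_minus_iff fps_neg_nth minus_diff_minus)

lemma fps_cong_diff: "fps_cong m K f f' \<Longrightarrow> fps_cong m K g g' \<Longrightarrow> fps_cong m K (f - g) (f' - g')"
  using fps_cong_add[OF _ fps_cong_uminus, of m K f f' g g'] by simp

lemma fps_cong_0_mult:
  assumes "fps_cong m K f 0" "fps_cong m' K g 0"
  shows "fps_cong (m * m') K (f * g) 0"
  using assms unfolding fps_cong_def by (auto simp: fps_mult_nth intro!: dvd_sum mult_dvd_mono)

lemma fps_cong_mult:
  assumes "fps_cong m K f f'" "fps_cong m K g g'"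
  shows "fps_cong m K (f * g) (f' * g')"
proof -
  have "fps_cong m K (f * (g - g')) 0"
    using fps_cong_0_mult[of 1 K f m "g - g'"] assms(2) by (simp add: fps_cong_def)
  moreover have "fps_cong m K ((f - f') * g') 0"
    using fps_cong_0_mult[of m K "f - f'" 1 g'] assms(1) by (simp add: fps_cong_def)
  ultimately have "fps_cong m K (f * (g - g') + (f - f') * g') (0 + 0)"
    by (rule fps_cong_add)
  then show ?thesis
    by (subst fps_cong_diff_iff) (simp add: algebra_simps)
qed

lemma fps_cong_power: "fps_cong m K f g \<Longrightarrow> fps_cong m K (f ^ n) (g ^ n)"
  by (induction n) (auto intro: fps_cong_mult)

lemma fps_cong_sum:
  "(\<And>i. i \<in> I \<Longrightarrow> fps_cong m K (f i) (g i)) \<Longrightarrow> fps_cong m K (sum f I) (sum g I)"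
  by (induction I rule: infinite_finite_induct) (auto intro!: fps_cong_add)

lemma fps_cong_prod:
  "(\<And>i. i \<in> I \<Longrightarrow> fps_cong m K (f i) (g i)) \<Longrightarrow> fps_cong m K (prod f I) (prod g I)"
  by (induction I rule: infinite_finite_induct) (auto intro!: fps_cong_mult)

lemma fps_cong_of_int_mult:
  "fps_cong m K (of_int m * f) 0"
  by (simp add: fps_cong_def fps_of_int[symmetric])

lemma fps_cong_X_power: "K \<le> e \<Longrightarrow> fps_cong m K (fps_X ^ e * f) 0"
  by (simp add: fps_cong_def fps_X_power_mult_nth)

text \<open>A series with constant term \<open>1\<close> is a unit modulo every such ideal; comparing coefficients from the
  lowest upwards shows this without forming the inverse.\<close>
lemma fps_cong_cancel:
  assumes u: "fps_nth u 0 = 1" and uf: "fps_cong m K (u * f) (u * g)"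
  shows "fps_cong m K f g"
proof -
  have *: "fps_cong m K (u * (f - g)) 0"
    using uf fps_cong_diff_iff by (metis right_diff_distrib)
  have "m dvd fps_nth (f - g) n" if "n < K" for n
    using that
  proof (induction n rule: less_induct)
    case (less n)
    have "fps_nth (u * (f - g)) n
        = (\<Sum>i=1..n. fps_nth u i * fps_nth (f - g) (n - i)) + fps_nth (f - g) n"
      using u by (simp add: fps_mult_nth sum.atLeast_Suc_atMost)
    moreover have "m dvd (\<Sum>i=1..n. fps_nth u i * fps_nth (f - g) (n - i))"
      using less by (intro dvd_sum dvd_mult) auto
    moreover have "m dvd fps_nth (u * (f - g)) n"
      using fps_congD[OF * less.prems] by simp
    ultimately show ?case
      by (metis dvd_add_right_iff)
  qed
  then show ?thesis by (simp add: fps_cong_def)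
qed

text \<open>This reduces a congruence deduced from another one to a ring identity: the difference of the two sides is a
  multiple of the known difference plus a multiple of \<open>m\<close>.\<close>
lemma fps_cong_linear:
  assumes "fps_cong m K f g" "f' - g' = a * (f - g) + of_int m * d"
  shows "fps_cong m K f' g'"
proof -
  have "fps_cong m K (a * (f - g) + of_int m * d) (a * 0 + 0)"
    using assms(1) by (intro fps_cong_add fps_cong_mult fps_cong_of_int_mult)
      (auto simp: fps_cong_diff_iff[of _ _ f g])
  then show ?thesis
    using assms(2) by (simp add: fps_cong_diff_iff[of _ _ f' g'])
qed

section \<open>The Euler operator\<close>

text \<open>The operator \<open>X d/dX\<close>. It multiplies the \<open>n\<close>-th coefficient by \<open>n\<close>, so modulo \<open>3\<close> it sees exactly the
  coefficients whose index is prime to \<open>3\<close>.\<close>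
definition fps_euler :: "int fps \<Rightarrow> int fps" where
  "fps_euler f = fps_X * fps_deriv f"

lemma fps_euler_nth [simp]: "fps_nth (fps_euler f) n = of_nat n * fps_nth f n"
  by (cases n) (auto simp: fps_euler_def)

lemma fps_euler_mult: "fps_euler (f * g) = f * fps_euler g + fps_euler f * g"
  by (simp add: fps_euler_def algebra_simps)

lemma fps_euler_diff: "fps_euler (f - g) = fps_euler f - fps_euler g"
  by (simp add: fps_euler_def algebra_simps)

lemma fps_euler_power: "fps_euler (f ^ n) = of_nat n * f ^ (n - 1) * fps_euler f"
  by (simp add: fps_euler_def fps_deriv_power fps_of_nat mult_ac)

lemma fps_euler_cong: "fps_cong m K f g \<Longrightarrow> fps_cong m K (fps_euler f) (fps_euler g)"
  by (auto simp: fps_cong_def right_diff_distrib[symmetric])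

section \<open>A finite Jacobi triple product\<close>

text \<open>The recursion is the Pascal rule that avoids subtraction in the exponent; the other rule is
  \<open>q_binomial_pascal\<close>. No division is needed, so \<open>q\<close> may lie in any commutative ring.\<close>
fun q_binomial :: "'a::comm_ring_1 \<Rightarrow> nat \<Rightarrow> nat \<Rightarrow> 'a" where
  "q_binomial q n 0 = 1"
| "q_binomial q 0 (Suc k) = 0"
| "q_binomial q (Suc n) (Suc k) = q ^ Suc k * q_binomial q n (Suc k) + q_binomial q n k"

lemma q_binomial_eq_0: "n < k \<Longrightarrow> q_binomial q n k = 0"
  by (induction q n k rule: q_binomial.induct) auto

lemma q_binomial_pascal:
  "k \<le> n \<Longrightarrow>
     q_binomial q (Suc n) (Suc k) = q_binomial q n (Suc k) + q ^ (n - k) * q_binomial q n k"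
proof (induction n arbitrary: k)
  case 0
  then show ?case by simp
next
  case (Suc n)
  show ?case
  proof (cases k)
    case 0
    have "q_binomial q (Suc n) (Suc 0) = q_binomial q n (Suc 0) + q ^ n"
      using Suc.IH[of 0] by simp
    moreover have "q_binomial q (Suc n) (Suc 0) = q * q_binomial q n (Suc 0) + 1" by simp
    ultimately show ?thesis 
      by (simp add: 0 algebra_simps)
  next
    case (Suc j)
    show ?thesis
    proof (cases "k \<le> n")
      case True
      obtain d where d: "n = k + d" using True le_Suc_ex by blast
      have 1: "q_binomial q (Suc n) (Suc k) = q_binomial q n (Suc k) + q ^ d * q_binomial q n k"
        using Suc.IH[of k] d by simp
      have 2: "q_binomial q (Suc n) k = q_binomial q n k + q ^ Suc d * q_binomial q n j"
        using Suc.IH[of j] d Suc by simp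
      have "q_binomial q (Suc (Suc n)) (Suc k) =
          q ^ Suc k * q_binomial q (Suc n) (Suc k) + q_binomial q (Suc n) k" by simp
      also have "\<dots> = q ^ Suc k * (q_binomial q n (Suc k) + q ^ d * q_binomial q n k)
            + (q_binomial q n k + q ^ Suc d * q_binomial q n j)" unfolding 1 2 ..
      also have "\<dots> = (q ^ Suc k * q_binomial q n (Suc k) + q_binomial q n k)
           + q ^ Suc d * (q ^ Suc j * q_binomial q n (Suc j) + q_binomial q n j)"
        using Suc by (simp add: algebra_simps power_add)
      also have "\<dots> = q_binomial q (Suc n) (Suc k) + q ^ Suc d * q_binomial q (Suc n) k"
        using Suc by simp
      finally show ?thesis using d by simp
    next
      case False
      then have "k = Suc n" using Suc.prems by simp
      then show ?thesis by (simp add: q_binomial_eq_0)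
    qed
  qed
qed

definition q_factorial :: "'a::comm_ring_1 \<Rightarrow> nat \<Rightarrow> 'a" where
  "q_factorial q n = (\<Prod>i<n. 1 - q ^ Suc i)"

lemma q_factorial_Suc: "q_factorial q (Suc n) = q_factorial q n * (1 - q ^ Suc n)"
  by (simp add: q_factorial_def)

lemma q_factorial_0 [simp]: "q_factorial q 0 = 1"
  by (simp add: q_factorial_def)

text \<open>The product formula for Gaussian binomials with the denominators cleared. It shows that
  the central coefficients tend to \<open>1 / (q; q)\<^sub>\<infinity>\<close> in the \<open>q\<close>-adic topology.\<close>
lemma q_binomial_factorial:
  "q_binomial q (k + l) k * q_factorial q k * q_factorial q l = q_factorial q (k + l)"
proof (induction "k + l" arbitrary: k l)
  case 0
  then show ?case by simp
next
  case (Suc n)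
  show ?case
  proof (cases k)
    case 0
    then show ?thesis by simp
  next
    case k: (Suc i)
    show ?thesis
    proof (cases l)
      case 0
      have "q_binomial q k k = 1" for k
        by (induction k) (auto simp: q_binomial_eq_0)
      then show ?thesis using 0 by simp
    next
      case l: (Suc j)
      have n: "n = Suc (i + j)" using Suc k l by simp
      have 1: "q_binomial q n (Suc i) * q_factorial q (Suc i) * q_factorial q j = q_factorial q n"
        using Suc.hyps(1)[of "Suc i" j] n by simp
      have 2: "q_binomial q n i * q_factorial q i * q_factorial q (Suc j) = q_factorial q n"
        using Suc.hyps(1)[of i "Suc j"] n by simp
      have "q_binomial q (Suc n) (Suc i) * q_factorial q (Suc i) * q_factorial q (Suc j) =
         q ^ Suc i * (1 - q ^ Suc j) * (q_binomial q n (Suc i) * q_factorial q (Suc i) * q_factorial q j)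
         + (1 - q ^ Suc i) * (q_binomial q n i * q_factorial q i * q_factorial q (Suc j))"
        by (simp add: q_factorial_Suc[of q i] q_factorial_Suc[of q j] algebra_simps)
      also have "\<dots> = q_factorial q n * (1 - q ^ Suc n)"
        unfolding 1 2 by (simp add: n algebra_simps power_add)
      finally show ?thesis using k l n by (simp add: q_factorial_Suc)
    qed
  qed
qed

definition triangle :: "int \<Rightarrow> nat" where
  "triangle j = nat (j * (j + 1) div 2)"

lemma triangle: "2 * int (triangle j) = j * (j + 1)"
proof -
  have "even (j * (j + 1))" by simp
  moreover have "0 \<le> j * (j + 1)"
    by (cases "0 \<le> j") (auto simp: mult_nonpos_nonpos)
  ultimately show ?thesis by (simp add: triangle_def)
qed

lemma triangle_step: "int (triangle j) = int (triangle (j - 1)) + j"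
  using triangle[of j] triangle[of "j - 1"] by (simp add: algebra_simps)

lemma triangle_square: "triangle j + triangle (j - 1) = nat (j ^ 2)"
  using triangle[of j] triangle[of "j - 1"] by (simp add: algebra_simps power2_eq_square)

text \<open>The terms of Ramanujan's theta function \<open>f(a, b)\<close>. Two parameters with \<open>q = a b\<close> replace the usual
  \<open>z\<close> and \<open>1/z\<close>, so no inverses occur.\<close>
definition theta_term :: "'a::comm_ring_1 \<Rightarrow> 'a \<Rightarrow> int \<Rightarrow> 'a" where
  "theta_term a b j = a ^ triangle j * b ^ triangle (j - 1)"

text \<open>Each new linear factor is absorbed by one Pascal rule: a factor \<open>1 + a q\<^sup>M\<close> by \<open>q_binomial_pascal\<close>,
  a factor \<open>1 + b q\<^sup>L\<close> by the defining recursion. The facts \<open>shift\<close> in the proof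
  match the powers of \<open>q\<close> with the ratio of consecutive theta terms.\<close>
lemma finite_jacobi_triple_product:
  fixes a b :: "'a::comm_ring_1"
  shows "(\<Prod>i<M. 1 + a * (a * b) ^ i) * (\<Prod>i<L. 1 + b * (a * b) ^ i) =
    (\<Sum>l\<le>M + L. q_binomial (a * b) (M + L) l * theta_term a b (int l - int L))"
proof (induction M)
  case 0
  show ?case
  proof (induction L)
    case 0
    then show ?case by (simp add: theta_term_def triangle_def)
  next
    case (Suc L)
    let ?A = "theta_term a b" and ?B = "q_binomial (a * b)"
    have shift: "(a * b) ^ l * ?A (int l - int (Suc L)) = b * (a * b) ^ L * ?A (int l - int L)" for l
    proof -
      have "int (l + triangle (int l - int (Suc L))) = int (L + triangle (int l - int L))"
        "int (l + triangle (int l - int (Suc L) - 1)) = int (1 + L + triangle (int l - int L - 1))"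
        using triangle_step[of "int l - int L"] triangle_step[of "int l - int L - 1"]
        by (simp_all add: algebra_simps)
      then have "a ^ (l + triangle (int l - int (Suc L))) = a ^ (L + triangle (int l - int L))"
        "b ^ (l + triangle (int l - int (Suc L) - 1)) = b ^ (1 + L + triangle (int l - int L - 1))"
        by (metis of_nat_eq_iff)+
      then have "a ^ (l + triangle (int l - int (Suc L))) * b ^ (l + triangle (int l - int (Suc L) - 1)) =
         a ^ (L + triangle (int l - int L)) * b ^ (1 + L + triangle (int l - int L - 1))" by simp
      then show ?thesis
        by (simp add: theta_term_def power_add power_mult_distrib mult_ac)
    qed
    have "(\<Sum>l\<le>Suc L. ?B (Suc L) l * ?A (int l - int (Suc L)))
        = ?A (- int (Suc L)) + (\<Sum>l\<le>L. ?B (Suc L) (Suc l) * ?A (int l - int L))"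
      by (subst sum.atMost_Suc_shift) simp
    also have "(\<Sum>l\<le>L. ?B (Suc L) (Suc l) * ?A (int l - int L)) =
       (\<Sum>l\<le>L. (a * b) ^ Suc l * ?B L (Suc l) * ?A (int (Suc l) - int (Suc L)))
        + (\<Sum>l\<le>L. ?B L l * ?A (int l - int L))"
      by (simp add: algebra_simps sum.distrib)
    also have "?A (- int (Suc L)) + \<dots> =
       (\<Sum>l\<le>Suc L. (a * b) ^ l * ?B L l * ?A (int l - int (Suc L)))
        + (\<Sum>l\<le>L. ?B L l * ?A (int l - int L))"
      by (subst sum.atMost_Suc_shift) simp
    also have "(\<Sum>l\<le>Suc L. (a * b) ^ l * ?B L l * ?A (int l - int (Suc L))) =
       (\<Sum>l\<le>L. (a * b) ^ l * ?B L l * ?A (int l - int (Suc L)))"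
      by (simp add: q_binomial_eq_0)
    also have "\<dots> = b * (a * b) ^ L * (\<Sum>l\<le>L. ?B L l * ?A (int l - int L))"
      unfolding sum_distrib_left
    proof (intro sum.cong refl)
      fix l
      show "(a * b) ^ l * ?B L l * ?A (int l - int (Suc L)) =
          b * (a * b) ^ L * (?B L l * ?A (int l - int L))"
        using arg_cong[OF shift[of l], of "\<lambda>z. z * ?B L l"] by (simp only: mult_ac)
    qed
    finally show ?case using Suc by (simp add: algebra_simps)
  qed
next
  case (Suc M)
  let ?A = "theta_term a b" and ?B = "q_binomial (a * b)"
  define n where "n = M + L"
  have shift: "(a * b) ^ (n - l) * ?A (int (Suc l) - int L) = a * (a * b) ^ M * ?A (int l - int L)"
    if "l \<le> n" for l
  proof -
    have "int (n - l + triangle (int (Suc l) - int L)) = int (1 + M + triangle (int l - int L))"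
      "int (n - l + triangle (int (Suc l) - int L - 1)) = int (M + triangle (int l - int L - 1))"
      using triangle_step[of "int (Suc l) - int L"] triangle_step[of "int l - int L"] that
      by (simp_all add: algebra_simps of_nat_diff n_def)
    then have "a ^ (n - l + triangle (int (Suc l) - int L)) = a ^ (1 + M + triangle (int l - int L))"
      "b ^ (n - l + triangle (int (Suc l) - int L - 1)) = b ^ (M + triangle (int l - int L - 1))"
      by (metis of_nat_eq_iff)+
    then have "a ^ (n - l + triangle (int (Suc l) - int L)) * b ^ (n - l + triangle (int (Suc l) - int L - 1)) =
       a ^ (1 + M + triangle (int l - int L)) * b ^ (M + triangle (int l - int L - 1))" by simp
    then show ?thesis
      by (simp add: theta_term_def power_add power_mult_distrib mult_ac)
  qed
  have "(\<Sum>l\<le>Suc n. ?B (Suc n) l * ?A (int l - int L))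
      = ?A (- int L) + (\<Sum>l\<le>n. ?B (Suc n) (Suc l) * ?A (int (Suc l) - int L))"
    by (subst sum.atMost_Suc_shift) simp
  also have "(\<Sum>l\<le>n. ?B (Suc n) (Suc l) * ?A (int (Suc l) - int L)) =
     (\<Sum>l\<le>n. ?B n (Suc l) * ?A (int (Suc l) - int L)
        + (a * b) ^ (n - l) * ?B n l * ?A (int (Suc l) - int L))"
    by (intro sum.cong refl, subst q_binomial_pascal) (auto simp: algebra_simps)
  also have "\<dots> = (\<Sum>l\<le>n. ?B n (Suc l) * ?A (int (Suc l) - int L))
      + (\<Sum>l\<le>n. (a * b) ^ (n - l) * ?B n l * ?A (int (Suc l) - int L))"
    by (rule sum.distrib)
  also have "?A (- int L) + \<dots> = (\<Sum>l\<le>Suc n. ?B n l * ?A (int l - int L))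
      + (\<Sum>l\<le>n. (a * b) ^ (n - l) * ?B n l * ?A (int (Suc l) - int L))"
    by (subst sum.atMost_Suc_shift) simp
  also have "(\<Sum>l\<le>Suc n. ?B n l * ?A (int l - int L)) = (\<Sum>l\<le>n. ?B n l * ?A (int l - int L))"
    by (simp add: q_binomial_eq_0)
  also have "(\<Sum>l\<le>n. (a * b) ^ (n - l) * ?B n l * ?A (int (Suc l) - int L)) =
     a * (a * b) ^ M * (\<Sum>l\<le>n. ?B n l * ?A (int l - int L))"
    unfolding sum_distrib_left
  proof (intro sum.cong refl)
    fix l assume "l \<in> {..n}"
    then show "(a * b) ^ (n - l) * ?B n l * ?A (int (Suc l) - int L) =
        a * (a * b) ^ M * (?B n l * ?A (int l - int L))"
      using arg_cong[OF shift[of l], of "\<lambda>z. z * ?B n l"] by (simp only: mult_ac atMost_iff)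
  qed
  finally show ?case using Suc by (simp add: algebra_simps n_def)
qed

section \<open>Truncated products\<close>

definition fps_qprod :: "int \<Rightarrow> nat \<Rightarrow> nat \<Rightarrow> nat \<Rightarrow> int fps" where
  "fps_qprod c r s N = (\<Prod>i<N. 1 - fps_const c * fps_X ^ (r + s * i))"

lemma fps_qprod_nth_0: "r > 0 \<Longrightarrow> fps_nth (fps_qprod c r s N) 0 = 1"
  unfolding fps_qprod_def by (induction N) simp_all

lemma fps_qprod_stable:
  assumes "N \<le> M" "K \<le> r + s * N"
  shows "fps_cong m K (fps_qprod c r s M) (fps_qprod c r s N)"
  using assms(1)
proof (induction M rule: dec_induct)
  case base
  then show ?case by simp
next
  case (step M)
  have "s * N \<le> s * M" using step by simp
  then have "K \<le> r + s * M" using assms(2) by linarith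
  then have "fps_cong m K (1 - fps_X ^ (r + s * M) * fps_const c) (1 - 0)"
    by (intro fps_cong_diff fps_cong_X_power fps_cong_refl)
  then have "fps_cong m K (fps_qprod c r s M * (1 - fps_const c * fps_X ^ (r + s * M)))
      (fps_qprod c r s N * 1)"
    using step.IH by (intro fps_cong_mult) (simp_all add: mult.commute)
  then show ?case by (simp add: fps_qprod_def)
qed

text \<open>For \<open>P(X\<^sup>3)\<close> this isolates the factors whose exponents are divisible by \<open>9\<close>, which form \<open>P(X\<^sup>9)\<close>.\<close>
lemma fps_qprod_triple:
  "fps_qprod c r s (3 * N) =
     fps_qprod c r (3 * s) N * fps_qprod c (r + s) (3 * s) N * fps_qprod c (r + 2 * s) (3 * s) N"
proof (induction N)
  case 0
  then show ?case by (simp add: fps_qprod_def)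
next
  case (Suc N)
  let ?f = "\<lambda>e. 1 - fps_const c * fps_X ^ e :: int fps"
  have "3 * Suc N = Suc (Suc (Suc (3 * N)))" by simp
  then have "fps_qprod c r s (3 * Suc N) = fps_qprod c r s (3 * N) *
      ?f (r + s * (3 * N)) * ?f (r + s * Suc (3 * N)) * ?f (r + s * Suc (Suc (3 * N)))"
    by (simp only: fps_qprod_def prod.lessThan_Suc)
  moreover have "r + s * (3 * N) = r + 3 * s * N" "r + s * Suc (3 * N) = r + s + 3 * s * N"
    "r + s * Suc (Suc (3 * N)) = r + 2 * s + 3 * s * N" by simp_all
  ultimately show ?case
    unfolding Suc by (simp only: fps_qprod_def prod.lessThan_Suc mult_ac)
qed

text \<open>The Frobenius map: modulo \<open>3\<close>, cubing replaces \<open>X\<close> by \<open>X\<^sup>3\<close>.\<close>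
lemma fps_qprod_cube:
  "fps_cong 3 K (fps_qprod (-1) r s N ^ 3) (fps_qprod (-1) (3 * r) (3 * s) N)"
  unfolding fps_qprod_def prod_power_distrib
proof (rule fps_cong_prod)
  fix i
  let ?x = "fps_X ^ (r + s * i) :: int fps"
  have x3: "fps_X ^ (3 * r + 3 * s * i) = ?x ^ 3"
    by (simp add: power_mult[symmetric] algebra_simps)
  have m1: "fps_const (-1 :: int) = - 1" by (simp flip: fps_const_neg)
  show "fps_cong 3 K ((1 - fps_const (-1) * ?x) ^ 3)
      (1 - fps_const (-1) * fps_X ^ (3 * r + 3 * s * i))"
    by (rule fps_cong_linear[where f = 0 and g = 0 and a = 0 and d = "?x + ?x ^ 2"])
      (simp_all only: x3 m1, simp_all add: power2_eq_square power3_eq_cube algebra_simps)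
qed

text \<open>The expansion of \<open>X\<^sup>d / (1 - c X\<^sup>d)\<close>; see \<open>lambert_term\<close>.\<close>
definition lambert_term :: "int \<Rightarrow> nat \<Rightarrow> int fps" where
  "lambert_term c d = Abs_fps (\<lambda>n. if d dvd n \<and> n > 0 then c ^ (n div d - 1) else 0)"

lemma lambert_term:
  assumes "d > 0"
  shows "(1 - fps_const c * fps_X ^ d) * lambert_term c d = fps_X ^ d"
proof (rule fps_ext)
  fix n
  have "fps_nth ((1 - fps_const c * fps_X ^ d) * lambert_term c d) n =
      fps_nth (lambert_term c d) n - c * fps_nth (fps_X ^ d * lambert_term c d) n"
    by (simp add: left_diff_distrib mult.assoc)
  also have "\<dots> = fps_nth (fps_X ^ d) n"
  proof (cases "d dvd n")
    case False
    then show ?thesis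
      by (auto simp: fps_X_power_mult_nth lambert_term_def dvd_minus_self)
  next
    case True
    then obtain t where t: "n = d * t" by blast
    consider "t = 0" | "t = 1" | i where "t = Suc (Suc i)" by (metis One_nat_def not0_implies_Suc)
    then show ?thesis
    proof cases
      case 3
      then have "n - d = d * Suc i" "\<not> n < d" "n \<noteq> d" using t assms by (auto simp: algebra_simps)
      then show ?thesis
        using t 3 assms by (simp add: fps_X_power_mult_nth lambert_term_def)
    qed (use t assms in \<open>auto simp: fps_X_power_mult_nth lambert_term_def\<close>)
  qed
  finally show "fps_nth ((1 - fps_const c * fps_X ^ d) * lambert_term c d) n = fps_nth (fps_X ^ d) n" .
qed

lemma fps_euler_X_power: "fps_euler (fps_X ^ d) = of_nat d * fps_X ^ d"
  by (rule fps_ext) (auto simp flip: fps_of_nat)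

lemma fps_euler_const_mult: "fps_euler (fps_const c * f) = fps_const c * fps_euler f"
  by (rule fps_ext) simp

lemma fps_euler_1: "fps_euler 1 = 0"
  by (rule fps_ext) auto

lemma fps_euler_qprod:
  assumes "r > 0"
  shows "fps_euler (fps_qprod c r s N) =
    - fps_const c * fps_qprod c r s N *
      (\<Sum>i<N. of_nat (r + s * i) * lambert_term c (r + s * i))"
proof (induction N)
  case 0
  then show ?case by (simp add: fps_qprod_def fps_euler_1)
next
  case (Suc N)
  define d where "d = r + s * N"
  let ?f = "1 - fps_const c * fps_X ^ d :: int fps"
  have "fps_euler ?f = - fps_const c * of_nat d * fps_X ^ d"
    by (simp add: fps_euler_diff fps_euler_1 fps_euler_const_mult fps_euler_X_power mult_ac
        flip: fps_const_neg)
  also have "\<dots> = - fps_const c * of_nat d * (?f * lambert_term c d)"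
    using assms by (subst lambert_term) (simp_all add: d_def)
  finally have f: "fps_euler ?f = \<dots>" .
  have "fps_qprod c r s (Suc N) = fps_qprod c r s N * ?f"
    by (simp add: fps_qprod_def d_def)
  moreover have "fps_euler (fps_qprod c r s N * ?f) = - fps_const c * (fps_qprod c r s N * ?f) *
      ((\<Sum>i<N. of_nat (r + s * i) * lambert_term c (r + s * i)) + of_nat d * lambert_term c d)"
    unfolding fps_euler_mult f Suc.IH by (simp only: algebra_simps)
  ultimately show ?case by (simp add: d_def)
qed

text \<open>In the central range of \<open>finite_jacobi_triple_product\<close> the factor \<open>(q; q)\<^sub>N\<close> turns the Gaussian binomial
  into \<open>1\<close> up to order \<open>K\<close>; outside of it the theta term has order at least \<open>j\<^sup>2 \<ge> K\<close>. The bound \<open>2 * K \<le> N\<close>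
  makes both lower indices of the central binomials at least \<open>K\<close>.\<close>
lemma jacobi_triple_product_truncated:
  assumes "\<alpha> > 0" "\<beta> > 0" "s = \<alpha> + \<beta>" "2 * K \<le> N"
  shows "fps_cong m K
    (fps_qprod 1 s s N * (fps_qprod (-1) \<alpha> s N * fps_qprod (-1) \<beta> s N))
    (\<Sum>j\<in>{- int N..int N}. fps_X ^ (\<alpha> * triangle j + \<beta> * triangle (j - 1)))"
proof -
  let ?q = "fps_X ^ s :: int fps"
  let ?A = "\<lambda>j. fps_X ^ (\<alpha> * triangle j + \<beta> * triangle (j - 1)) :: int fps"
  let ?B = "q_binomial ?q (2 * N)"
  let ?F = "fps_qprod 1 s s"
  have q: "fps_X ^ \<alpha> * fps_X ^ \<beta> = ?q" using assms by (simp add: power_add)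
  have fact: "q_factorial ?q n = ?F n" for n
    by (simp add: q_factorial_def fps_qprod_def flip: power_mult power_add)
  have m1: "fps_const (-1 :: int) = - 1" by (simp flip: fps_const_neg)
  have lin: "(\<Prod>i<N. 1 + fps_X ^ e * ?q ^ i) = fps_qprod (-1) e s N" for e
    by (simp add: fps_qprod_def m1 flip: power_mult power_add)
  have tt: "theta_term (fps_X ^ \<alpha>) (fps_X ^ \<beta>) j = ?A j" for j
    by (simp add: theta_term_def flip: power_mult power_add)
  have "fps_qprod (-1) \<alpha> s N * fps_qprod (-1) \<beta> s N = (\<Sum>l\<le>2 * N. ?B l * ?A (int l - int N))"
    using finite_jacobi_triple_product[of "fps_X ^ \<alpha> :: int fps" "fps_X ^ \<beta>" N N]
    by (simp add: q lin tt mult_2)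
  then have "?F N * (fps_qprod (-1) \<alpha> s N * fps_qprod (-1) \<beta> s N) =
      (\<Sum>l\<le>2 * N. ?F N * ?B l * ?A (int l - int N))"
    by (simp add: sum_distrib_left mult.assoc)
  also have "fps_cong m K \<dots> (\<Sum>l\<le>2 * N. ?A (int l - int N))"
  proof (rule fps_cong_sum)
    fix l assume l: "l \<in> {..2 * N}"
    show "fps_cong m K (?F N * ?B l * ?A (int l - int N)) (?A (int l - int N))"
    proof (cases "\<bar>int l - int N\<bar> \<le> int K")
      case True
      define l' where "l' = 2 * N - l"
      have ge: "K \<le> l" "K \<le> l'" "K \<le> N" "l + l' = 2 * N"
        using True l assms by (auto simp: l'_def)
      have F: "fps_cong m K (?F n) (?F K)" "fps_cong m K (?F K) (?F n)" if "K \<le> n" for n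
      proof -
        have "K * 1 \<le> K * s" using assms by (intro mult_left_mono) auto
        then have "K \<le> s + s * K" by (metis mult.commute mult_1 trans_le_add2)
        then show "fps_cong m K (?F n) (?F K)" using that by (intro fps_qprod_stable)
        then show "fps_cong m K (?F K) (?F n)" by (rule fps_cong_sym)
      qed
      have "fps_cong m K (?F K * (?F N * ?B l)) (?F l' * (?F l * ?B l))"
        using fps_cong_mult[OF F(2)[of l'] fps_cong_mult[OF fps_cong_trans[OF F(1)[of N] F(2)[of l]]
            fps_cong_refl[of m K "?B l"]]] ge by blast
      also have "?F l' * (?F l * ?B l) = ?F (2 * N)"
        using q_binomial_factorial[of ?q l l'] ge by (simp add: fact mult_ac)
      also have "fps_cong m K \<dots> (?F K * 1)"
        using F(1)[of "2 * N"] ge by simp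
      finally have "fps_cong m K (?F N * ?B l) 1"
        by (rule fps_cong_cancel[rotated]) (use assms in \<open>simp add: fps_qprod_nth_0\<close>)
      then have "fps_cong m K (?F N * ?B l * ?A (int l - int N)) (1 * ?A (int l - int N))"
        by (intro fps_cong_mult fps_cong_refl)
      then show ?thesis by simp
    next
      case False
      define j where "j = int l - int N"
      have "\<bar>j\<bar> * 1 \<le> \<bar>j\<bar> * \<bar>j\<bar>" using False j_def by (intro mult_left_mono) auto
      then have "\<bar>j\<bar> \<le> j ^ 2" by (simp add: power2_eq_square)
      then have "K \<le> triangle j + triangle (j - 1)"
        using False triangle_square[of j] j_def by simp
      also have "\<dots> \<le> \<alpha> * triangle j + \<beta> * triangle (j - 1)"
        using assms by (intro add_mono) simp_all
      finally have A0: "fps_cong m K (?A j * x) 0" for x by (rule fps_cong_X_power)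
      show ?thesis
        using fps_cong_trans[OF A0[of "?F N * ?B l"] fps_cong_sym[OF A0[of 1]]]
        by (simp add: j_def mult_ac)
    qed
  qed
  also have "(\<Sum>l\<le>2 * N. ?A (int l - int N)) = (\<Sum>j\<in>{- int N..int N}. ?A j)"
    by (rule sum.reindex_bij_witness[where j = "\<lambda>l. int l - int N" and i = "\<lambda>j. nat (j + int N)"])
      auto
  finally show ?thesis .
qed

section \<open>Three-dissection of the theta series\<close>

lemma sum_symmetric_Suc:
  fixes f :: "int \<Rightarrow> 'a::comm_monoid_add"
  shows "(\<Sum>j\<in>{- int (Suc n)..int (Suc n)}. f j) =
    (\<Sum>j\<in>{- int n..int n}. f j) + f (int (Suc n)) + f (- int (Suc n))"
proof -
  have "{- int (Suc n)..int (Suc n)} = insert (- int (Suc n)) (insert (int (Suc n)) {- int n..int n})"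
    by auto
  then show ?thesis by (simp add: add_ac)
qed

text \<open>The ranges match exactly because the outer bound is \<open>1\<close> modulo \<open>3\<close>: no boundary terms remain.\<close>
lemma sum_symmetric_mod_3:
  fixes f :: "int \<Rightarrow> 'a::comm_monoid_add"
  shows "(\<Sum>j\<in>{- int (3 * N + 1)..int (3 * N + 1)}. f j) =
    (\<Sum>j\<in>{- int N..int N}. f (3 * j)) + (\<Sum>j\<in>{- int N..int N}. f (3 * j + 1))
      + (\<Sum>j\<in>{- int N..int N}. f (- (3 * j + 1)))"
proof (induction N)
  case 0
  have "{-1..1} = {-1, 0, 1 :: int}" by auto
  then show ?case by (simp add: add_ac)
next
  case (Suc N)
  have e: "3 * Suc N + 1 = Suc (Suc (Suc (3 * N + 1)))" by simp
  show ?case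
    unfolding e sum_symmetric_Suc Suc by (simp add: algebra_simps)
qed

text \<open>The squares prime to \<open>3\<close> are \<open>(3 j + 1)\<^sup>2 = 9 j\<^sup>2 + 6 j + 1\<close>, each hit by \<open>3 j + 1\<close> and by its negative. Every
  exponent is written through triangular numbers so that the triple product applies on both sides;
  the trivial factors \<open>1\<close> have the same purpose.\<close>
lemma square_theta_dissection:
  "(\<Sum>j\<in>{- int (3 * N + 1)..int (3 * N + 1)}. fps_X ^ (1 * triangle j + 1 * triangle (j - 1)) :: int fps) =
   (\<Sum>j\<in>{- int N..int N}. fps_X ^ (9 * triangle j + 9 * triangle (j - 1)))
    + 2 * fps_X * (\<Sum>j\<in>{- int N..int N}. fps_X ^ (15 * triangle j + 3 * triangle (j - 1)))"
proof -
  let ?f = "\<lambda>j. fps_X ^ (1 * triangle j + 1 * triangle (j - 1)) :: int fps"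
  let ?g = "\<lambda>j. fps_X ^ (15 * triangle j + 3 * triangle (j - 1)) :: int fps"
  have "1 * triangle (3 * j) + 1 * triangle (3 * j - 1) = 9 * triangle j + 9 * triangle (j - 1)" for j
    using triangle[of "3 * j"] triangle[of "3 * j - 1"] triangle[of j] triangle[of "j - 1"]
    by (simp add: algebra_simps)
  then have 0: "?f (3 * j) = fps_X ^ (9 * triangle j + 9 * triangle (j - 1))" for j
    by (simp only:)
  have "1 * triangle (3 * j + 1) + 1 * triangle (3 * j + 1 - 1)
      = Suc (15 * triangle j + 3 * triangle (j - 1))" for j
    using triangle[of "3 * j + 1"] triangle[of "3 * j"] triangle[of j] triangle[of "j - 1"]
    by (simp add: algebra_simps)
  then have 1: "?f (3 * j + 1) = fps_X * ?g j" for j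
    by (simp only: power_Suc)
  have "1 * triangle (- (3 * j + 1)) + 1 * triangle (- (3 * j + 1) - 1)
      = Suc (15 * triangle j + 3 * triangle (j - 1))" for j
    using triangle[of "- (3 * j + 1)"] triangle[of "- (3 * j + 1) - 1"]
      triangle[of j] triangle[of "j - 1"]
    by (simp add: algebra_simps)
  then have 2: "?f (- (3 * j + 1)) = fps_X * ?g j" for j
    by (simp only: power_Suc)
  show ?thesis
    unfolding sum_symmetric_mod_3 0 1 2 sum_distrib_left[symmetric] by (simp only: mult_2 distrib_right add.assoc)
qed

text \<open>With \<open>t = X / P\<^sup>2\<^sup>4\<close> this says that the theta series is \<open>(1 - t) G\<close> modulo \<open>3\<close>, where \<open>G\<close> is a series in \<open>X\<^sup>9\<close>.
  The dissection and the triple product give \<open>E v\<^sup>2 + 2 X E w\<close> for the theta series. For \<open>u = P(X\<^sup>3)\<close> and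
  \<open>v = P(X\<^sup>9)\<close> the Frobenius map gives \<open>P\<^sup>3 = u\<close> and \<open>u\<^sup>3 = v\<close> modulo \<open>3\<close>, while \<open>u = v w\<close>; hence \<open>P\<^sup>2\<^sup>4 w = u\<^sup>9 / v = v\<^sup>2\<close>, and the second term
  multiplied by \<open>P\<^sup>2\<^sup>4\<close> is \<open>2 X E v\<^sup>2 = - X E v\<^sup>2\<close>.\<close>
lemma theta_congruence:
  fixes N K
  defines "P \<equiv> fps_qprod (-1) 1 2 (3 * N + 1)"
    and "E \<equiv> fps_qprod 1 18 18 N" and "v \<equiv> fps_qprod (-1) 9 18 N"
  assumes "2 * K \<le> N"
  shows "fps_cong 3 K (fps_qprod 1 2 2 (3 * N + 1) * P ^ 2 * P ^ 24)
    ((P ^ 24 - fps_X) * (E * v ^ 2))"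
proof -
  let ?e = "fps_qprod 1 2 2 (3 * N + 1)"
  define w where "w = fps_qprod (-1) 15 18 N * fps_qprod (-1) 3 18 N"
  define u where "u = fps_qprod (-1) 3 6 (3 * N)"
  have u: "u = v * w"
    unfolding u_def w_def v_def using fps_qprod_triple[of "-1" 3 6 N] by simp
  have 1: "fps_cong 3 K (?e * (P * P))
      (\<Sum>j\<in>{- int (3 * N + 1)..int (3 * N + 1)}. fps_X ^ (1 * triangle j + 1 * triangle (j - 1)))"
    unfolding P_def using assms(4) by (intro jacobi_triple_product_truncated) auto
  have 2: "fps_cong 3 K (E * (v * v))
      (\<Sum>j\<in>{- int N..int N}. fps_X ^ (9 * triangle j + 9 * triangle (j - 1)))"
    unfolding E_def v_def using assms(4) by (intro jacobi_triple_product_truncated) auto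
  have 3: "fps_cong 3 K (E * w)
      (\<Sum>j\<in>{- int N..int N}. fps_X ^ (15 * triangle j + 3 * triangle (j - 1)))"
    unfolding E_def w_def using assms(4) by (intro jacobi_triple_product_truncated) auto
  have theta: "fps_cong 3 K (?e * (P * P)) (E * (v * v) + 2 * fps_X * (E * w))"
    using fps_cong_trans[OF 1[unfolded square_theta_dissection] fps_cong_sym[OF fps_cong_add[OF 2
        fps_cong_mult[OF fps_cong_refl[of 3 K "2 * fps_X"] 3]]]] .
  have "fps_cong 3 K (P ^ 3) (fps_qprod (-1) (3 * 1) (3 * 2) (3 * N + 1))"
    unfolding P_def by (rule fps_qprod_cube)
  also have "fps_cong 3 K \<dots> (fps_qprod (-1) (3 * 1) (3 * 2) (3 * N))"
    using assms(4) by (intro fps_qprod_stable) auto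
  finally have "fps_cong 3 K (P ^ 3) u" by (simp add: u_def)
  then have "fps_cong 3 K ((P ^ 3) ^ 8) (u ^ 8)" by (rule fps_cong_power)
  then have Pu: "fps_cong 3 K (P ^ 24) (u ^ 8)" by (simp flip: power_mult)
  have "fps_cong 3 K (u ^ 3) (fps_qprod (-1) (3 * 3) (3 * 6) (3 * N))"
    unfolding u_def by (rule fps_qprod_cube)
  also have "fps_cong 3 K \<dots> (fps_qprod (-1) (3 * 3) (3 * 6) N)"
    using assms(4) by (intro fps_qprod_stable) auto
  finally have "fps_cong 3 K (u ^ 3) v" by (simp add: v_def)
  then have "fps_cong 3 K ((u ^ 3) ^ 3) (v ^ 3)" by (rule fps_cong_power)
  then have "fps_cong 3 K (u ^ 8 * u) (v ^ 3)" by (simp flip: power_mult power_Suc2)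
  then have "fps_cong 3 K (v * (u ^ 8 * w)) (v * v ^ 2)"
    by (simp add: u mult_ac power2_eq_square power3_eq_cube)
  then have "fps_cong 3 K (u ^ 8 * w) (v ^ 2)"
    by (rule fps_cong_cancel[rotated]) (simp add: v_def fps_qprod_nth_0)
  then have wP: "fps_cong 3 K (P ^ 24 * w) (v ^ 2)"
    using fps_cong_trans[OF fps_cong_mult[OF Pu fps_cong_refl]] by blast
  have "fps_cong 3 K (?e * (P * P) * P ^ 24) ((E * (v * v) + 2 * fps_X * (E * w)) * P ^ 24)"
    using theta by (intro fps_cong_mult) auto
  also have "(E * (v * v) + 2 * fps_X * (E * w)) * P ^ 24 =
      E * v ^ 2 * P ^ 24 + 2 * fps_X * E * (P ^ 24 * w)"
    by (simp add: algebra_simps power2_eq_square)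
  also have "fps_cong 3 K \<dots> ((P ^ 24 - fps_X) * (E * v ^ 2))"
    by (rule fps_cong_linear[OF wP, of _ _ "2 * fps_X * E" "fps_X * (E * v ^ 2)"])
      (simp add: algebra_simps)
  finally show ?thesis by (simp add: power2_eq_square mult.assoc)
qed

section \<open>Logarithmic derivatives\<close>

text \<open>The logarithmic derivative \<open>Q\<close> of \<open>P\<close>.\<close>
definition odd_lambert_series :: "nat \<Rightarrow> int fps" where
  "odd_lambert_series M = (\<Sum>i<M. of_nat (1 + 2 * i) * lambert_term (-1) (1 + 2 * i))"

text \<open>Half of the negative of the logarithmic derivative of \<open>\<Prod>(1 - X\<^sup>2\<^sup>i)\<close>.\<close>
definition even_lambert_series :: "nat \<Rightarrow> int fps" where
  "even_lambert_series M = (\<Sum>i<M. of_nat (i + 1) * lambert_term 1 (2 + 2 * i))"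

lemma fps_euler_qprod_odd:
  "fps_euler (fps_qprod (-1) 1 2 M) = fps_qprod (-1) 1 2 M * odd_lambert_series M"
proof -
  have "fps_const (-1 :: int) = - 1" by (simp flip: fps_const_neg)
  then show ?thesis by (simp add: fps_euler_qprod odd_lambert_series_def)
qed

lemma fps_euler_qprod_even:
  "fps_euler (fps_qprod 1 2 2 M) = - fps_qprod 1 2 2 M * (2 * even_lambert_series M)"
proof -
  have "(\<Sum>i<M. of_nat (2 + 2 * i) * lambert_term 1 (2 + 2 * i)) = 2 * even_lambert_series M"
    unfolding even_lambert_series_def sum_distrib_left
    by (intro sum.cong refl) (simp add: algebra_simps)
  then show ?thesis by (simp add: fps_euler_qprod)
qed

lemma fps_euler_qprod_multiple_of_3:
  assumes "r > 0" "3 dvd r" "3 dvd s"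
  shows "fps_cong 3 K (fps_euler (fps_qprod c r s N)) 0"
proof -
  have "fps_cong 3 K (\<Sum>i<N. of_nat (r + s * i) * lambert_term c (r + s * i)) (\<Sum>i<N. 0)"
  proof (rule fps_cong_sum)
    fix i
    obtain t where "r + s * i = 3 * t" using assms by (meson dvd_add dvd_def dvd_mult2)
    then show "fps_cong 3 K (of_nat (r + s * i) * lambert_term c (r + s * i)) 0"
      using fps_cong_of_int_mult[of 3 K "of_nat t * lambert_term c (r + s * i)"]
      by (simp add: mult.assoc)
  qed
  then show ?thesis
    using fps_cong_mult[OF fps_cong_refl[of 3 K "- fps_const c * fps_qprod c r s N"]] assms(1)
    by (fastforce simp: fps_euler_qprod)
qed

text \<open>The logarithmic derivative of \<open>theta_congruence\<close>. Modulo \<open>3\<close> the Euler operator kills \<open>P\<^sup>2\<^sup>4\<close> and \<open>G\<close>, so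
  the only contribution of the right-hand side comes from \<open>- X\<close>; the left-hand side contributes \<open>2 (Q - Y)\<close>.\<close>
lemma lambert_congruence:
  fixes N K
  defines "M \<equiv> 3 * N + 1"
  defines "P \<equiv> fps_qprod (-1) 1 2 M"
  assumes "2 * K \<le> N"
  shows "fps_cong 3 K ((P ^ 24 - fps_X) * (odd_lambert_series M - even_lambert_series M)) fps_X"
proof -
  define e where "e = fps_qprod 1 2 2 M"
  define E where "E = fps_qprod 1 18 18 N"
  define v where "v = fps_qprod (-1) 9 18 N"
  define Q where "Q = odd_lambert_series M"
  define Y where "Y = even_lambert_series M"
  define G where "G = E * v ^ 2"
  define T where "T = e * P ^ 2"
  have main: "fps_cong 3 K (T * P ^ 24) ((P ^ 24 - fps_X) * G)"
    using theta_congruence[OF assms(3)] by (simp add: T_def G_def e_def E_def v_def P_def M_def)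
  have DP: "fps_euler P = P * Q"
    unfolding P_def Q_def by (rule fps_euler_qprod_odd)
  have De: "fps_euler e = - e * (2 * Y)"
    unfolding e_def Y_def by (rule fps_euler_qprod_even)
  have DX: "fps_euler fps_X = fps_X"
    using fps_euler_X_power[of 1] by simp
  have P24: "fps_euler (P ^ 24) = 24 * (P ^ 24 * Q)"
    unfolding fps_euler_power DP using power_Suc2[of P 23] by (simp add: mult_ac)
  have T: "fps_euler T = T * (2 * (Q - Y))"
    unfolding T_def fps_euler_mult power2_eq_square DP De by (simp add: algebra_simps)
  have G0: "fps_cong 3 K (fps_euler G) 0"
  proof -
    have E: "fps_cong 3 K (fps_euler E) 0" and v: "fps_cong 3 K (fps_euler v) 0"
      unfolding E_def v_def by (intro fps_euler_qprod_multiple_of_3; simp)+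
    have "fps_euler G = 2 * E * v * fps_euler v + v ^ 2 * fps_euler E"
      unfolding G_def fps_euler_mult power2_eq_square by (simp add: algebra_simps)
    moreover have "fps_cong 3 K \<dots> (2 * E * v * 0 + v ^ 2 * 0)"
      using E v by (intro fps_cong_add fps_cong_mult) auto
    ultimately show ?thesis by simp
  qed
  have "fps_cong 3 K (T * P ^ 24 * (2 * (Q - Y))) ((P ^ 24 - fps_X) * G * (2 * (Q - Y)))"
    using fps_cong_mult[OF main fps_cong_refl] .
  moreover have "fps_cong 3 K (T * P ^ 24 * (2 * (Q - Y))) (- (fps_X * G))"
  proof -
    have L: "fps_euler (T * P ^ 24) = T * P ^ 24 * (2 * (Q - Y)) + 24 * (T * P ^ 24 * Q)"
      unfolding fps_euler_mult T P24 by (simp add: algebra_simps)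
    have R: "fps_euler ((P ^ 24 - fps_X) * G) =
        (P ^ 24 - fps_X) * fps_euler G + 24 * (P ^ 24 * Q * G) - fps_X * G"
      unfolding fps_euler_mult fps_euler_diff P24 DX by (simp add: algebra_simps)
    have "fps_cong 3 K (T * P ^ 24 * (2 * (Q - Y)) + 24 * (T * P ^ 24 * Q))
        ((P ^ 24 - fps_X) * fps_euler G + 24 * (P ^ 24 * Q * G) - fps_X * G)"
      using fps_euler_cong[OF main] unfolding L R .
    also have "fps_cong 3 K \<dots> ((P ^ 24 - fps_X) * 0 + 24 * (P ^ 24 * Q * G) - fps_X * G)"
      using G0 by (intro fps_cong_add fps_cong_diff fps_cong_mult) auto
    finally show ?thesis
      by (rule fps_cong_linear[where a = 1 and d = "8 * (P ^ 24 * Q * G) - 8 * (T * P ^ 24 * Q)"])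
        (simp add: algebra_simps)
  qed
  ultimately have "fps_cong 3 K ((P ^ 24 - fps_X) * G * (2 * (Q - Y))) (- (fps_X * G))"
    using fps_cong_trans fps_cong_sym by blast
  then have "fps_cong 3 K (G * ((P ^ 24 - fps_X) * (2 * (Q - Y)))) (G * (- fps_X))"
    by (simp add: mult_ac)
  then have "fps_cong 3 K ((P ^ 24 - fps_X) * (2 * (Q - Y))) (- fps_X)"
    by (rule fps_cong_cancel[rotated])
      (simp add: G_def E_def v_def fps_qprod_nth_0 fps_nth_power_0)
  then have "fps_cong 3 K ((P ^ 24 - fps_X) * (Q - Y)) fps_X"
    by (rule fps_cong_linear[where a = 2 and d = "- (P ^ 24 - fps_X) * (Q - Y) - fps_X"])
      (simp add: algebra_simps)
  then show ?thesis by (simp add: Q_def Y_def)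
qed

section \<open>Divisor sums modulo 3\<close>

text \<open>Pair \<open>d\<close> with \<open>n / d\<close>: the product of the two is \<open>2\<close> modulo \<open>3\<close>, so their sum is \<open>0\<close>.\<close>
lemma divisor_sum_mod_3:
  fixes n :: nat
  assumes "n mod 3 = 2"
  shows "3 dvd (\<Sum>d | d dvd n. int d)"
proof -
  have n0: "n > 0" using assms by (cases n) auto
  have "(\<Sum>d | d dvd n. int d) = (\<Sum>d | d dvd n. int (n div d))"
    by (rule sum.reindex_bij_witness[where i = "\<lambda>d. n div d" and j = "\<lambda>d. n div d"])
      (use n0 in auto)
  then have "2 * (\<Sum>d | d dvd n. int d) = (\<Sum>d | d dvd n. int (d + n div d))"
    by (simp add: sum.distrib)
  moreover have "3 dvd (\<Sum>d | d dvd n. int (d + n div d))"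
  proof (rule dvd_sum)
    fix d assume "d \<in> {d. d dvd n}"
    then obtain t where t: "n = d * t" by blast
    then have "n div d = t" using n0 by auto
    have "(d mod 3) * (t mod 3) mod 3 = 2" using assms t by (metis mod_mult_eq)
    moreover have "d mod 3 = 0 \<or> d mod 3 = 1 \<or> d mod 3 = 2"
      "t mod 3 = 0 \<or> t mod 3 = 1 \<or> t mod 3 = 2" by presburger+
    ultimately have "(d mod 3 + t mod 3) mod 3 = 0" by auto
    then have "3 dvd d + t" by presburger
    then show "3 dvd int (d + n div d)"
      using \<open>n div d = t\<close> by (metis int_dvd_int_iff of_nat_numeral)
  qed
  ultimately have "3 dvd 2 * (\<Sum>d | d dvd n. int d)" by simp
  then show ?thesis by presburger
qed

lemma fps_of_nat_mult_nth: "fps_nth (of_nat a * f) n = int a * fps_nth f n" for f :: "int fps"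
  by (metis fps_mult_left_const_nth fps_of_nat)

lemma odd_lambert_series_nth:
  assumes "0 < n" "n < M"
  shows "fps_nth (odd_lambert_series M) n = (\<Sum>d | d dvd n \<and> odd d. (-1) ^ (n div d - 1) * int d)"
proof -
  have "fps_nth (odd_lambert_series M) n =
      (\<Sum>i<M. if 1 + 2 * i dvd n then (-1) ^ (n div (1 + 2 * i) - 1) * int (1 + 2 * i) else 0)"
    unfolding odd_lambert_series_def fps_sum_nth fps_of_nat_mult_nth
    using assms by (intro sum.cong refl) (simp add: lambert_term_def)
  also have "\<dots> = (\<Sum>i\<in>{i\<in>{..<M}. 1 + 2 * i dvd n}. (-1) ^ (n div (1 + 2 * i) - 1) * int (1 + 2 * i))"
    by (rule sum.inter_filter[symmetric]) simp
  also have "\<dots> = (\<Sum>d | d dvd n \<and> odd d. (-1) ^ (n div d - 1) * int d)"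
    using assms dvd_imp_le[of _ n]
    by (intro sum.reindex_bij_witness[where i = "\<lambda>d. d div 2" and j = "\<lambda>i. 1 + 2 * i"])
      (auto simp: less_mult_imp_div_less elim!: oddE, fastforce)
  finally show ?thesis .
qed

lemma even_lambert_series_nth:
  assumes "0 < n" "n < M"
  shows "fps_nth (even_lambert_series M) n = (\<Sum>d | d dvd n \<and> even d. int (d div 2))"
proof -
  have "fps_nth (even_lambert_series M) n = (\<Sum>i<M. if 2 + 2 * i dvd n then int (i + 1) else 0)"
    unfolding even_lambert_series_def fps_sum_nth fps_of_nat_mult_nth
    using assms by (intro sum.cong refl) (simp add: lambert_term_def)
  also have "\<dots> = (\<Sum>i\<in>{i\<in>{..<M}. 2 + 2 * i dvd n}. int (i + 1))"
    by (rule sum.inter_filter[symmetric]) simp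
  also have "\<dots> = (\<Sum>d | d dvd n \<and> even d. int (d div 2))"
  proof (rule sum.reindex_bij_witness[where i = "\<lambda>d. d div 2 - 1" and j = "\<lambda>i. 2 + 2 * i"])
    fix d assume d: "d \<in> {d. d dvd n \<and> even d}"
    then have "d \<le> n" "0 < d" using assms dvd_imp_le by (auto intro: Nat.gr0I)
    then show *: "2 + 2 * (d div 2 - 1) = d" using d by (auto elim!: evenE)
    then show "d div 2 - 1 \<in> {i\<in>{..<M}. 2 + 2 * i dvd n}"
      using d assms \<open>d \<le> n\<close> by auto
  qed auto
  finally show ?thesis .
qed


text \<open>At indices prime to \<open>3\<close>, the unwanted series \<open>Y\<close> can be eliminated. If \<open>n\<close> is \<open>1\<close> modulo \<open>3\<close>, then \<open>Y\<close> has
  the coefficient \<open>\<sigma>(n/2)\<close> or \<open>0\<close>, which vanishes modulo \<open>3\<close> because \<open>n/2\<close> is \<open>2\<close> modulo \<open>3\<close>. If \<open>n\<close> is \<open>2\<close>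
  modulo \<open>3\<close>, then the coefficients of \<open>Q\<close> and \<open>Y\<close> add up to \<open>\<plusminus>\<sigma>(n) = 0\<close>, so \<open>Q - Y\<close> has the coefficient \<open>2 Q\<^sub>n\<close>.\<close>
lemma lambert_series_mod_3:
  assumes n: "n < M" "n mod 3 \<noteq> 0"
  shows "3 dvd int n * fps_nth (odd_lambert_series M) n
    - fps_nth (odd_lambert_series M - even_lambert_series M) n"
proof -
  let ?q = "fps_nth (odd_lambert_series M) n" and ?y = "fps_nth (even_lambert_series M) n"
  have n0: "n > 0" using n by (cases n) auto
  consider "n mod 3 = 1" | "n mod 3 = 2" using n by linarith
  then show ?thesis
  proof cases
    case 1
    have "3 dvd ?y"
    proof (cases "even n")
      case False
      then have no: "{d. d dvd n \<and> even d} = {}" by auto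
      show ?thesis unfolding even_lambert_series_nth[OF n0 n(1)] no by simp
    next
      case True
      then obtain t where t: "n = 2 * t" by blast
      have "?y = (\<Sum>d | d dvd t. int d)"
        unfolding even_lambert_series_nth[OF n0 n(1)]
        by (rule sum.reindex_bij_witness[where i = "\<lambda>d. 2 * d" and j = "\<lambda>d. d div 2"])
          (auto simp: t)
      moreover have "t mod 3 = 2" using 1 t by presburger
      ultimately show ?thesis using divisor_sum_mod_3 by simp
    qed
    then obtain y where "?y = 3 * y" by blast
    moreover have "n = 3 * (n div 3) + 1" using 1 by presburger
    then obtain m where "n = 3 * m + 1" by blast
    ultimately have "int n * ?q - fps_nth (odd_lambert_series M - even_lambert_series M) n
        = 3 * (int m * ?q + y)" by (simp add: algebra_simps)
    then show ?thesis by simp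
  next
    case 2
    have fin: "finite {d. d dvd n}" using n0 by simp
    have split: "(\<Sum>d | d dvd n. int d) = (\<Sum>d | d dvd n \<and> odd d. int d) + (\<Sum>d | d dvd n \<and> even d. int d)"
    proof -
      have un: "{d. d dvd n \<and> odd d} \<union> {d. d dvd n \<and> even d} = {d. d dvd n}" by blast
      have "(\<Sum>d\<in>{d. d dvd n \<and> odd d} \<union> {d. d dvd n \<and> even d}. int d) =
          (\<Sum>d | d dvd n \<and> odd d. int d) + (\<Sum>d | d dvd n \<and> even d. int d)"
        using fin by (intro sum.union_disjoint) auto
      then show ?thesis unfolding un .
    qed
    have "(\<Sum>d | d dvd n \<and> even d. int d) = (\<Sum>d | d dvd n \<and> even d. 2 * int (d div 2))"
      by (intro sum.cong refl) auto
    then have ev: "(\<Sum>d | d dvd n \<and> even d. int d) = 2 * ?y"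
      unfolding even_lambert_series_nth[OF n0 n(1)] by (simp add: sum_distrib_left)
    have "3 dvd ?q + ?y"
    proof (cases "even n")
      case True
      have "(\<Sum>d | d dvd n \<and> odd d. (-1) ^ (n div d - 1) * int d) = (\<Sum>d | d dvd n \<and> odd d. - int d)"
      proof (intro sum.cong refl)
        fix d assume "d \<in> {d. d dvd n \<and> odd d}"
        then obtain t where "n = d * t" "odd d" by blast
        then have "n div d = t" "even t" "t > 0" using True n0 by auto
        then have "odd (n div d - 1)" by simp
        then show "(-1) ^ (n div d - 1) * int d = - int d" by simp
      qed
      then have "?q = - (\<Sum>d | d dvd n \<and> odd d. int d)"
        unfolding odd_lambert_series_nth[OF n0 n(1)] by (simp add: sum_negf)
      then have "?q + ?y = 3 * ?y - (\<Sum>d | d dvd n. int d)"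
        using split ev by simp
      then show ?thesis using divisor_sum_mod_3[OF 2] by simp
    next
      case False
      then have no: "{d. d dvd n \<and> even d} = {}" by auto
      have "(\<Sum>d | d dvd n \<and> odd d. (-1) ^ (n div d - 1) * int d) = (\<Sum>d | d dvd n \<and> odd d. int d)"
      proof (intro sum.cong refl)
        fix d assume "d \<in> {d. d dvd n \<and> odd d}"
        then obtain t where "n = d * t" "odd d" by blast
        then have "n div d = t" "odd t" using False by auto
        then show "(-1) ^ (n div d - 1) * int d = int d" by simp
      qed
      then have "?q = (\<Sum>d | d dvd n. int d)"
        unfolding odd_lambert_series_nth[OF n0 n(1)] using split no by simp
      moreover have "?y = 0" unfolding even_lambert_series_nth[OF n0 n(1)] no by simp
      ultimately show ?thesis using divisor_sum_mod_3[OF 2] by simp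
    qed
    then obtain y where "?q + ?y = 3 * y" by blast
    then have "?y = 3 * y - ?q" by simp
    moreover have "n = 3 * (n div 3) + 2" using 2 by presburger
    then obtain m where "n = 3 * m + 2" by blast
    ultimately have "int n * ?q - fps_nth (odd_lambert_series M - even_lambert_series M) n
        = 3 * (int m * ?q + y)" by (simp add: algebra_simps)
    then show ?thesis by simp
  qed
qed

section \<open>The Newman--Shanks--Zagier numbers modulo 3\<close>

text \<open>For \<open>1 \<le> k \<le> M\<close> this is \<open>a\<^sub>k\<close>: applying \<open>X d/dX\<close> to \<open>P\<^bsup>24k\<^esup>\<close> and cancelling \<open>k\<close> shows that \<open>24 a\<^sub>k\<close> is
  \<open>24\<close> times the coefficient below. In particular \<open>a\<^sub>k\<close> is an integer.\<close>
definition nsz_int :: "nat \<Rightarrow> nat \<Rightarrow> int" where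
  "nsz_int M k = fps_nth (fps_qprod (-1) 1 2 M ^ (24 * k) * odd_lambert_series M) k"

lemma fps_euler_P_power:
  "fps_euler (fps_qprod (-1) 1 2 M ^ n) =
     of_nat n * (fps_qprod (-1) 1 2 M ^ n * odd_lambert_series M)"
proof (cases n)
  case 0
  then show ?thesis by (simp add: fps_euler_1)
next
  case (Suc m)
  then show ?thesis
    unfolding fps_euler_power fps_euler_qprod_odd by (simp only: power_Suc diff_Suc_1 mult_ac)
qed

lemma nsz_int:
  assumes "k \<ge> 1"
  shows "fps_nth (fps_qprod (-1) 1 2 M ^ (24 * k)) k = 24 * nsz_int M k"
proof -
  have "int k * fps_nth (fps_qprod (-1) 1 2 M ^ (24 * k)) k
      = fps_nth (fps_euler (fps_qprod (-1) 1 2 M ^ (24 * k))) k" by simp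
  also have "\<dots> = int k * (24 * nsz_int M k)"
    unfolding fps_euler_P_power fps_of_nat_mult_nth nsz_int_def by simp
  finally show ?thesis using assms by simp
qed

text \<open>Put \<open>R = Q - Y\<close> and let \<open>r\<^sub>j\<close> be the coefficient of \<open>X\<^sup>j\<close> in \<open>P\<^bsup>24j\<^esup> R\<close>. Since \<open>P\<^sup>2\<^sup>4 R = X + X R\<close> modulo \<open>3\<close>,
  \<open>r\<^sub>j\<^sub>+\<^sub>1\<close> is \<open>r\<^sub>j\<close> plus the coefficient of \<open>X\<^sup>j\<close> in \<open>P\<^bsup>24j\<^esup>\<close>, which is \<open>1\<close> for \<open>j = 0\<close> and \<open>24 a\<^sub>j = 0\<close>
  afterwards; so \<open>r\<^sub>k = 1\<close>. On the other hand \<open>P\<^bsup>24k\<^esup>\<close> is a series in \<open>X\<^sup>3\<close> modulo \<open>3\<close>, so only the coefficients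
  of \<open>R\<close> at indices congruent to \<open>k\<close> enter \<open>r\<^sub>k\<close>, and there \<open>R\<close> agrees with \<open>k Q\<close>.\<close>
lemma nsz_int_mod_3:
  fixes N k
  defines "M \<equiv> 3 * N + 1"
  assumes "2 * (k + 1) \<le> N" "k mod 3 \<noteq> 0"
  shows "3 dvd int k * nsz_int M k - 1"
proof -
  define P where "P = fps_qprod (-1) 1 2 M"
  define Q where "Q = odd_lambert_series M"
  define R where "R = odd_lambert_series M - even_lambert_series M"
  have "fps_cong 3 (k + 1) ((P ^ 24 - fps_X) * R) fps_X"
    using lambert_congruence[OF assms(2)] by (simp add: P_def R_def M_def)
  then have PR: "fps_cong 3 (k + 1) (P ^ 24 * R) (fps_X * (1 + R))"
    by (rule fps_cong_linear[where a = 1 and d = 0]) (simp add: algebra_simps)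
  have R0: "fps_nth R 0 = 0"
    unfolding R_def odd_lambert_series_def even_lambert_series_def
    by (simp add: fps_sum_nth fps_of_nat_mult_nth lambert_term_def)
  have step: "3 dvd fps_nth (P ^ (24 * Suc j) * R) (Suc j)
      - (fps_nth (P ^ (24 * j)) j + fps_nth (P ^ (24 * j) * R) j)" if "Suc j \<le> k" for j
  proof -
    have "fps_cong 3 (k + 1) (P ^ (24 * j) * (P ^ 24 * R)) (P ^ (24 * j) * (fps_X * (1 + R)))"
      by (rule fps_cong_mult[OF fps_cong_refl PR])
    also have "P ^ (24 * j) * (P ^ 24 * R) = P ^ (24 * Suc j) * R"
      using power_add[of P "24 * j" 24] by (simp add: add.commute mult.assoc)
    also have "P ^ (24 * j) * (fps_X * (1 + R)) = fps_X * (P ^ (24 * j) + P ^ (24 * j) * R)"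
      by (simp add: algebra_simps)
    finally show ?thesis
      using that by (auto dest: fps_congD[where n = "Suc j"])
  qed
  have r: "3 dvd fps_nth (P ^ (24 * Suc j) * R) (Suc j) - 1" if "Suc j \<le> k" for j
    using that
  proof (induction j)
    case 0
    then show ?case using step[of 0] R0 by simp
  next
    case (Suc j)
    have "3 dvd fps_nth (P ^ (24 * Suc j) * R) (Suc j) - 1"
      using Suc by simp
    moreover have "fps_nth (P ^ (24 * Suc j)) (Suc j) = 24 * nsz_int M (Suc j)"
      unfolding P_def by (rule nsz_int) simp
    ultimately show ?case
      using step[OF Suc.prems] by presburger
  qed
  have k0: "k = Suc (k - 1)" using assms(3) by (cases k) auto
  have "3 dvd fps_nth (P ^ (24 * k) * R) k - 1"
    using r[of "k - 1"] unfolding k0[symmetric] by simp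
  moreover have "3 dvd int k * nsz_int M k - fps_nth (P ^ (24 * k) * R) k"
  proof -
    have "int k * nsz_int M k - fps_nth (P ^ (24 * k) * R) k =
       (\<Sum>i=0..k. fps_nth (P ^ (24 * k)) i * (int k * fps_nth Q (k - i) - fps_nth R (k - i)))"
      unfolding nsz_int_def P_def[symmetric] Q_def[symmetric] fps_mult_nth
      by (simp add: sum_distrib_left right_diff_distrib sum_subtractf mult_ac)
    also have "3 dvd \<dots>"
    proof (rule dvd_sum)
      fix i assume i: "i \<in> {0..k}"
      show "3 dvd fps_nth (P ^ (24 * k)) i * (int k * fps_nth Q (k - i) - fps_nth R (k - i))"
      proof (cases "i mod 3 = 0")
        case False
        have "int i * fps_nth (P ^ (24 * k)) i = fps_nth (fps_euler (P ^ (24 * k))) i" by simp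
        also have "\<dots> = 3 * (8 * int k * fps_nth (P ^ (24 * k) * Q) i)"
          unfolding P_def Q_def fps_euler_P_power fps_of_nat_mult_nth by simp
        finally have "3 dvd int i * fps_nth (P ^ (24 * k)) i" by simp
        then have "coprime 3 (int i) \<Longrightarrow> 3 dvd fps_nth (P ^ (24 * k)) i"
          by (simp add: coprime_dvd_mult_right_iff)
        moreover have "coprime 3 (int i)"
          using False by (intro prime_imp_coprime) (simp, presburger)
        ultimately have "3 dvd fps_nth (P ^ (24 * k)) i" by blast
        then show ?thesis by simp
      next
        case True
        have "i \<le> k" using i by simp
        then have "(k - i) mod 3 \<noteq> 0" using True assms(3) by presburger
        moreover have "k - i < M" using assms(2) by (simp add: M_def)
        ultimately have R: "3 dvd int (k - i) * fps_nth Q (k - i) - fps_nth R (k - i)"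
          unfolding Q_def R_def by (intro lambert_series_mod_3)
        obtain m where "i = 3 * m" using True by (metis mod_eq_0_iff_dvd dvd_def)
        then have k: "int k = int (k - i) + 3 * int m" using \<open>i \<le> k\<close> by simp
        have "int k * fps_nth Q (k - i) - fps_nth R (k - i) =
            (int (k - i) * fps_nth Q (k - i) - fps_nth R (k - i)) + 3 * (int m * fps_nth Q (k - i))"
          by (subst k) (simp add: algebra_simps)
        also have "3 dvd \<dots>"
          by (rule dvd_add[OF R dvd_triv_left])
        finally show ?thesis by (rule dvd_mult)
      qed
    qed
    finally show ?thesis .
  qed
  ultimately show ?thesis by presburger
qed

text \<open>\<open>P\<^sup>3 = P(X\<^sup>3)\<close> modulo \<open>3\<close> implies \<open>P\<^sup>9 = P(X\<^sup>3)\<^sup>3\<close> modulo \<open>9\<close>. Hence \<open>P\<^bsup>72k\<^esup> = P(X\<^sup>3)\<^bsup>24k\<^esup>\<close>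
  modulo \<open>9\<close>, and comparing the coefficients of \<open>X\<^bsup>3k\<^esup>\<close> gives \<open>24 a\<^bsub>3k\<^esub> = 24 a\<^sub>k\<close> modulo \<open>9\<close>.\<close>
lemma nsz_int_triple:
  assumes "k \<ge> 1"
  shows "3 dvd nsz_int M (3 * k) - nsz_int M k"
proof -
  define P where "P = fps_qprod (-1) 1 2 M"
  define P3 where "P3 = fps_qprod (-1) 3 6 M"
  define K where "K = 3 * k + 1"
  have P3: "P3 = P oo fps_X ^ 3"
  proof -
    have "(fps_X ^ e) oo (fps_X ^ 3) = (fps_X ^ (3 * e) :: int fps)" for e
      by (rule fps_ext) (auto simp: fps_nth_compose_X_power elim!: dvdE)
    moreover have X0: "fps_nth (fps_X ^ 3 :: int fps) 0 = 0" by simp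
    ultimately have "(1 - fps_const (-1) * fps_X ^ (1 + 2 * i)) oo fps_X ^ 3
        = (1 - fps_const (-1) * fps_X ^ (3 + 6 * i) :: int fps)" for i
      by (simp only: fps_compose_sub_distrib fps_compose_mult_distrib[OF X0] fps_compose_1
          fps_const_compose) (simp add: algebra_simps)
    then show ?thesis
      by (simp only: P_def P3_def fps_qprod_def fps_compose_prod_distrib[OF X0])
  qed
  have c: "fps_cong 3 K (P ^ 3) P3"
    unfolding P_def P3_def using fps_qprod_cube[of K 1 2 M] by simp
  \<comment> \<open>The second factor of \<open>a\<^sup>3 - b\<^sup>3 = (a - b) (a\<^sup>2 + a b + b\<^sup>2)\<close> supplies the extra factor \<open>3\<close>.\<close>
  have "fps_cong 3 K (P ^ 3 * P ^ 3 + P ^ 3 * P3 + P3 * P3) (P3 * P3 + P3 * P3 + P3 * P3)"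
    using c by (intro fps_cong_add fps_cong_mult) auto
  also have "fps_cong 3 K \<dots> 0"
    using fps_cong_of_int_mult[of 3 K "P3 * P3"] by (simp add: algebra_simps)
  finally have "fps_cong (3 * 3) K ((P ^ 3 - P3) * (P ^ 3 * P ^ 3 + P ^ 3 * P3 + P3 * P3)) 0"
    using c by (intro fps_cong_0_mult) (simp_all add: fps_cong_diff_iff[of _ _ "P ^ 3" P3])
  then have "fps_cong 9 K ((P ^ 3) ^ 3) (P3 ^ 3)"
    by (subst fps_cong_diff_iff) (simp add: power3_eq_cube algebra_simps)
  then have "fps_cong 9 K (((P ^ 3) ^ 3) ^ (8 * k)) ((P3 ^ 3) ^ (8 * k))"
    by (rule fps_cong_power)
  then have "fps_cong 9 K (P ^ (24 * (3 * k))) (P3 ^ (24 * k))"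
    by (simp flip: power_mult)
  then have "9 dvd fps_nth (P ^ (24 * (3 * k))) (3 * k) - fps_nth (P3 ^ (24 * k)) (3 * k)"
    by (rule fps_congD) (simp add: K_def)
  moreover have "fps_nth (P3 ^ (24 * k)) (3 * k) = fps_nth (P ^ (24 * k)) k"
    by (simp add: P3 fps_compose_power fps_nth_compose_X_power)
  ultimately have "9 dvd 24 * (nsz_int M (3 * k) - nsz_int M k)"
    using nsz_int[of k M] nsz_int[of "3 * k" M] assms by (simp add: P_def)
  then show ?thesis by presburger
qed

text \<open>The factors \<open>3\<close> of \<open>k\<close> are stripped one at a time by \<open>nsz_int_triple\<close>, until \<open>nsz_int_mod_3\<close> applies.\<close>
lemma not_3_dvd_nsz_int:
  assumes "k \<ge> 1" "2 * (k + 1) \<le> N"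
  shows "\<not> 3 dvd nsz_int (3 * N + 1) k"
  using assms
proof (induction k rule: less_induct)
  case (less k)
  show ?case
  proof (cases "k mod 3 = 0")
    case False
    have "3 dvd int k * nsz_int (3 * N + 1) k - 1"
      using less.prems(2) False by (rule nsz_int_mod_3)
    then have "3 dvd int k * nsz_int (3 * N + 1) k \<Longrightarrow> 3 dvd (1 :: int)"
      by presburger
    then show ?thesis
      using dvd_mult[of 3 "nsz_int (3 * N + 1) k" "int k"] by auto
  next
    case True
    then obtain j where j: "k = 3 * j" by (metis mod_eq_0_iff_dvd dvd_def)
    then have "\<not> 3 dvd nsz_int (3 * N + 1) j"
      using less.IH[of j] less.prems by simp
    moreover have "3 dvd nsz_int (3 * N + 1) k - nsz_int (3 * N + 1) j"
      unfolding j using less.prems j by (intro nsz_int_triple) simp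
    ultimately show ?thesis by presburger
  qed
qed

definition rat_fps :: "int fps \<Rightarrow> rat fps" where
  "rat_fps f = Abs_fps (\<lambda>n. of_int (fps_nth f n))"

lemma rat_fps_nth [simp]: "fps_nth (rat_fps f) n = of_int (fps_nth f n)"
  by (simp add: rat_fps_def)

lemma rat_fps_mult: "rat_fps (f * g) = rat_fps f * rat_fps g"
  by (rule fps_ext) (simp add: fps_mult_nth)

lemma rat_fps_1: "rat_fps 1 = 1"
  by (rule fps_ext) simp

lemma rat_fps_power: "rat_fps (f ^ k) = rat_fps f ^ k"
  by (induction k) (simp_all add: rat_fps_mult rat_fps_1)

lemma rat_fps_prod: "rat_fps (prod f I) = (\<Prod>i\<in>I. rat_fps (f i))"
  by (induction I rule: infinite_finite_induct) (simp_all add: rat_fps_mult rat_fps_1)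

lemma prodinf_fps_eqI:
  fixes f :: "nat \<Rightarrow> rat fps"
  assumes "\<And>n i. n \<le> i \<Longrightarrow> fps_nth (\<Prod>j\<le>i. f j) n = fps_nth L n" "L \<noteq> 0"
  shows "prodinf f = L"
proof -
  have "(\<lambda>i. \<Prod>j\<le>i. f j) \<longlonglongrightarrow> L"
    using assms(1) by (intro tendsto_fpsI) (auto simp: eventually_at_top_linorder)
  then have "f has_prod L" using assms(2) by (simp add: has_prod_def raw_has_prod_def)
  then show ?thesis by (metis has_prod_unique)
qed

text \<open>The exponents \<open>2 i + 1\<close> exceed \<open>n\<close> from \<open>i = n\<close> on, so \<open>n\<close> factors already
  determine the coefficient of \<open>X\<^sup>n\<close> in the infinite product.\<close>
lemma nsz_product_nth:
  assumes "n \<le> M"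
  shows "fps_nth (nsz_product k) n = of_int (fps_nth (fps_qprod (-1) 1 2 M ^ (24 * k)) n)"
proof -
  define P where "P = (\<lambda>i. fps_qprod (-1) 1 2 i ^ (24 * k))"
  define L where "L = Abs_fps (\<lambda>n. of_int (fps_nth (P n) n) :: rat)"
  have stable: "fps_nth (P i) n = fps_nth (P n) n" if "n \<le> i" for i n
  proof -
    have "fps_cong 0 (n + 1) (P i) (P n)"
      unfolding P_def using that by (intro fps_cong_power fps_qprod_stable) auto
    then show ?thesis using fps_congD[of 0 "n + 1" "P i" "P n" n] by simp
  qed
  have partial: "(\<Prod>j\<le>i. (1 + fps_X ^ (2 * j + 1)) ^ (24 * k)) = rat_fps (P (Suc i))" for i
  proof -
    have "rat_fps (1 - fps_const (-1) * fps_X ^ (1 + 2 * j)) = 1 + fps_X ^ (2 * j + 1)" for j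
      by (rule fps_ext) simp
    then show ?thesis
      by (simp only: P_def fps_qprod_def rat_fps_power rat_fps_prod prod_power_distrib
          lessThan_Suc_atMost)
  qed
  have "fps_nth L 0 = 1"
    by (simp add: L_def P_def fps_qprod_def)
  then have "L \<noteq> 0" by auto
  moreover have "fps_nth (rat_fps (P (Suc i))) n = fps_nth L n" if "n \<le> i" for i n
    using stable[of n "Suc i"] that by (simp add: L_def)
  ultimately have "nsz_product k = L"
    unfolding nsz_product_def by (intro prodinf_fps_eqI) (auto simp only: partial)
  then show ?thesis using stable[OF assms] by (simp add: L_def P_def)
qed

lemma nsz_seq_eq_nsz_int:
  assumes "1 \<le> k" "k \<le> M"
  shows "nsz_seq k = of_int (nsz_int M k)"
  using assms nsz_int[OF assms(1), of M] by (simp add: nsz_seq_def nsz_product_nth)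

section \<open>Additivity of valuations\<close>

text \<open>The fraction need not be reduced: a common factor adds the same amount to both multiplicities.\<close>
lemma padic_ord_fraction:
  assumes "prime p" "a \<noteq> 0" "b \<noteq> 0"
  shows "padic_ord p (of_int a / of_int b) = Fin (int (multiplicity (int p) a) - int (multiplicity (int p) b))"
proof -
  let ?x = "of_int a / of_int b :: rat"
  obtain c d where q: "quotient_of ?x = (c, d)" by fastforce
  have d: "d > 0" using quotient_of_denom_pos[OF q] .
  have x: "?x = of_int c / of_int d" using quotient_of_div[OF q] .
  have c: "c \<noteq> 0" using x assms by auto
  have "of_int (a * d) = (of_int (c * b) :: rat)"
    using x assms d by (simp add: field_simps)
  then have eq: "a * d = c * b" by (simp only: of_int_eq_iff)
  have p: "prime_elem (int p)" using assms by simp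
  have "multiplicity (int p) a + multiplicity (int p) d = multiplicity (int p) c + multiplicity (int p) b"
    using arg_cong[OF eq, of "multiplicity (int p)"] assms c d
    by (simp add: prime_elem_multiplicity_mult_distrib[OF p])
  then show ?thesis
    using assms q by (simp add: padic_ord_def)
qed

lemma padic_ord_mult:
  assumes "prime p" "padic_ord p x = Fin m" "padic_ord p y = Fin n"
  shows "padic_ord p (x * y) = Fin (m + n)"
proof -
  have nz: "x \<noteq> 0" "y \<noteq> 0" using assms(2,3) by (auto simp: padic_ord_def)
  obtain a b where x: "b > 0" "x = of_int a / of_int b"
    by (metis quotient_of_denom_pos quotient_of_div surj_pair)
  obtain c d where y: "d > 0" "y = of_int c / of_int d"
    by (metis quotient_of_denom_pos quotient_of_div surj_pair)
  have p: "prime_elem (int p)" using assms by simp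
  have nz': "a \<noteq> 0" "c \<noteq> 0" using nz x y by auto
  have xy: "x * y = of_int (a * c) / of_int (b * d)" using x y by simp
  have "padic_ord p (x * y) = Fin (int (multiplicity (int p) (a * c)) - int (multiplicity (int p) (b * d)))"
    unfolding xy using nz' x y assms(1) by (intro padic_ord_fraction) auto
  also have "\<dots> = Fin (m + n)"
    using assms(2,3) nz' x y
      padic_ord_fraction[OF assms(1), of a b] padic_ord_fraction[OF assms(1), of c d]
    by (simp add: prime_elem_multiplicity_mult_distrib[OF p])
  finally show ?thesis .
qed

lemma padic_ord_of_int:
  assumes "prime p" "a \<noteq> 0"
  shows "padic_ord p (of_int a) = Fin (int (multiplicity (int p) a))"
  using padic_ord_fraction[OF assms, of 1] by simp

lemma padic_ord_24: "padic_ord 2 24 = Fin 3" "padic_ord 3 24 = Fin 1"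
proof -
  have "multiplicity 2 (24::int) = 3" by (rule multiplicity_eqI) auto
  then show "padic_ord 2 24 = Fin 3" using padic_ord_of_int[of 2 24] by simp
  have "multiplicity 3 (24::int) = 1" by (rule multiplicity_eqI) auto
  then show "padic_ord 3 24 = Fin 1" using padic_ord_of_int[of 3 24] by simp
qed

lemma padic_ord_3_nsz_seq:
  assumes "k \<ge> 1"
  shows "padic_ord 3 (nsz_seq k) = Fin 0"
proof -
  define M where "M = 3 * (2 * (k + 1)) + 1"
  have n3: "\<not> 3 dvd nsz_int M k"
    unfolding M_def using assms by (intro not_3_dvd_nsz_int) simp_all
  then have "multiplicity 3 (nsz_int M k) = 0" "nsz_int M k \<noteq> 0"
    by (auto simp: not_dvd_imp_multiplicity_0)
  moreover have "nsz_seq k = of_int (nsz_int M k)"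
    using assms by (intro nsz_seq_eq_nsz_int) (simp_all add: M_def)
  ultimately show ?thesis using padic_ord_of_int[of 3 "nsz_int M k"] by simp
qed

theorem corollary1:
  fixes J :: "nat \<Rightarrow> complex \<Rightarrow> complex"
    and h p :: "nat \<Rightarrow> rat poly"
    and \<nu> :: "nat \<Rightarrow> rat"
  assumes hauptmodul: "\<And>m. m \<ge> 3 \<Longrightarrow> hecke_hauptmodul m (J m)"
    and interpolation:
      "\<And>k m. k \<ge> 1 \<Longrightarrow> m \<ge> 3 \<Longrightarrow> of_rat (poly (h k) (of_nat m)) = const_term J k m"
    and factorization: "\<And>k. k \<ge> 1 \<Longrightarrow> h k = smult (\<nu> k) (p k) \<and> lead_coeff (p k) = 1"
    and leading: "\<And>k. k \<ge> 1 \<Longrightarrow> \<nu> k = 24 * nsz_seq k"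
    and odd_at_3: "\<And>k. k \<ge> 1 \<Longrightarrow> padic_ord 2 (poly (p k) 3) = Fin 0"
    and ord_2_nsz: "\<And>k. k \<ge> 1 \<Longrightarrow> padic_ord 2 (nsz_seq k) = Fin (3 * int (digit_sum 2 k) - 3)"
    and ord_3_at_3: "\<And>k. k \<ge> 1 \<Longrightarrow> padic_ord 3 (poly (p k) 3) = Fin (int (digit_sum 3 k) - 1)"
  shows "\<forall>k\<ge>1. \<exists>r :: rat. const_term J k 3 = of_rat r \<and>
           padic_ord 2 r = Fin (3 * int (digit_sum 2 k)) \<and>
           padic_ord 3 r = Fin (int (digit_sum 3 k))"
proof (intro allI impI)
  fix k :: nat
  assume k: "1 \<le> k"
  let ?r = "24 * nsz_seq k * poly (p k) 3"
  have "poly (h k) 3 = ?r"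
    using factorization[OF k] leading[OF k] by simp
  then have "const_term J k 3 = of_rat ?r"
    using interpolation[OF k, of 3] by simp
  moreover have "padic_ord 2 ?r = Fin (3 + (3 * int (digit_sum 2 k) - 3) + 0)"
    by (intro padic_ord_mult padic_ord_24 ord_2_nsz[OF k] odd_at_3[OF k]) simp_all
  moreover have "padic_ord 3 ?r = Fin (1 + 0 + (int (digit_sum 3 k) - 1))"
    by (intro padic_ord_mult padic_ord_24 padic_ord_3_nsz_seq[OF k] ord_3_at_3[OF k]) simp_all
  ultimately show "\<exists>r. const_term J k 3 = of_rat r \<and>
      padic_ord 2 r = Fin (3 * int (digit_sum 2 k)) \<and> padic_ord 3 r = Fin (int (digit_sum 3 k))"
    by (intro exI[of _ ?r]) simp
qed

end
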